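(* Fix a positive real $M$. Then the Zariski closures of the four semi-axes $\mathbb{R}_+\times\{0\}$, $\mathbb{R}_-\times\{0\}$, $\{0\}\times\mathbb{R}_+$ and $\{0\}\times\mathbb{R}_-$ are as follows: $$\mathrm{zclos}_{\Gamma_M}(\mathbb{R}_+\times\{0\})=\mathrm{zclos}_{\Gamma_M}(\{0\}\times\mathbb{R}_-)=\bar{\mathbb{R}}_+\times\bar{\mathbb{R}}_-$$ and $$\mathrm{zclos}_{\Gamma_M}(\mathbb{R}_-\times\{0\})=\mathrm{zclos}_{\Gamma_M}(\{0\}\times\mathbb{R}_+)=\bar{\mathbb{R}}_-\times\bar{\mathbb{R}}_+.$$
   Context: $\mathbb{R}_+=\{t>0\}$, $\mathbb{R}_-=\{t<0\}$, $\bar{\mathbb{R}}_+=\{t\ge0\}$, $\bar{\mathbb{R}}_-=\{t\le0\}$. For a finite complex-valued Borel measure $\mu$ on $\mathbb{R}^2$, its Fourier transform is $\hat\mu(\xi)=\int_{\mathbb{R}^2}\mathrm{e}^{\mathrm{i}\pi\langle x,\xi\rangle}\,\mathrm{d}\mu(x)$, where $\langle x,\xi\rangle=x_1\xi_1+x_2\xi_2$. $\Gamma_M=\{x\in\mathbb{R}^2:\ x_1x_2=M^2/(4\pi^2)\}$, and $\mathrm{AC}(\Gamma_M)$ is the space of finite complex-valued Borel measures on $\mathbb{R}^2$ supported on $\Gamma_M$ that are absolutely continuous with respect to arc length measure on $\Gamma_M$. For $\Lambda\subset\mathbb{R}^2$, the Zariski closure $\mathrm{zclos}_{\Gamma_M}(\Lambda)$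 is the set of all $\xi\in\mathbb{R}^2$ such that $\hat\mu(\xi)=0$ for every $\mu\in\mathrm{AC}(\Gamma_M)$ with $\hat\mu=0$ on $\Lambda$. *)

theory Defs
  imports "HOL-Analysis.Analysis"
begin

section \<open>Complex measures and their integrals\<close>

text \<open>
  A complex measure is a countably additive complex-valued set function (hence automatically
  finite).  Its values outside \<open>sets M\<close> are irrelevant and left unconstrained.
\<close>

definition complex_measure :: "'a measure \<Rightarrow> ('a set \<Rightarrow> complex) \<Rightarrow> bool" where
  "complex_measure M \<mu> \<longleftrightarrow>
     (\<forall>A :: nat \<Rightarrow> 'a set. range A \<subseteq> sets M \<longrightarrow> disjoint_family A \<longrightarrow>
        (\<lambda>i. \<mu> (A i)) sums \<mu> (\<Union>i. A i))"

text \<open>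
  The positive variation of a real signed measure, i.e. the positive part of its Jordan
  decomposition.  The coercion \<^const>\<open>ennreal\<close> truncates negative values to 0, which does not
  affect the supremum since the empty set competes with value 0.  The negative part is the
  positive variation of the negated set function.
\<close>

definition pos_variation :: "'a measure \<Rightarrow> ('a set \<Rightarrow> real) \<Rightarrow> 'a measure" where
  "pos_variation M \<nu> =
     measure_of (space M) (sets M) (\<lambda>A. SUP B \<in> {B \<in> sets M. B \<subseteq> A}. ennreal (\<nu> B))"

definition complex_measure_integral ::
    "'a measure \<Rightarrow> ('a set \<Rightarrow> complex) \<Rightarrow> ('a \<Rightarrow> complex) \<Rightarrow> complex" where
  "complex_measure_integral M \<mu> f =
     (integral\<^sup>L (pos_variation M (\<lambda>A. Re (\<mu> A))) f
        - integral\<^sup>L (pos_variation M (\<lambda>A. - Re (\<mu> A))) f)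
     + \<i> * (integral\<^sup>L (pos_variation M (\<lambda>A. Im (\<mu> A))) f
        - integral\<^sup>L (pos_variation M (\<lambda>A. - Im (\<mu> A))) f)"

text \<open>
  The supremum above really is countably additive, so \<^const>\<open>measure_of\<close> does not
  degenerate to the zero measure.
\<close>

lemma emeasure_pos_variation:
  assumes add: "\<And>A :: nat \<Rightarrow> 'a set. range A \<subseteq> sets M \<Longrightarrow> disjoint_family A \<Longrightarrow>
                  (\<lambda>i. \<nu> (A i)) sums \<nu> (\<Union>i. A i)"
    and X: "X \<in> sets M"
  shows "emeasure (pos_variation M \<nu>) X = (SUP B \<in> {B \<in> sets M. B \<subseteq> X}. ennreal (\<nu> B))"
proof -
  define F where "F A = (SUP B \<in> {B \<in> sets M. B \<subseteq> A}. ennreal (\<nu> B))" for A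
  have ub: "ennreal (\<nu> B) \<le> F A" if "B \<in> sets M" "B \<subseteq> A" for A B
    unfolding F_def using that by (intro SUP_upper) auto
  have "(\<lambda>i::nat. \<nu> {}) sums \<nu> {}"
    using add[of "\<lambda>_. {}"] by (simp add: disjoint_family_on_def)
  then have empty: "\<nu> {} = 0"
    using summable_LIMSEQ_zero[of "\<lambda>i::nat. \<nu> {}"] by (auto simp: sums_iff LIMSEQ_const_iff)
  have fin_add: "\<nu> (A \<union> B) = \<nu> A + \<nu> B"
    if "A \<in> sets M" "B \<in> sets M" "A \<inter> B = {}" for A B
  proof -
    have "(\<lambda>i. \<nu> (binaryset A B i)) sums \<nu> (\<Union>i. binaryset A B i)"
      using that by (intro add)
        (auto simp: range_binaryset_eq disjoint_family_on_def binaryset_def)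
    moreover have "(\<lambda>i. \<nu> (binaryset A B i)) sums (\<nu> A + \<nu> B)"
      using binaryset_sums[of \<nu> A B] empty by simp
    ultimately show ?thesis
      by (metis UN_binaryset_eq sums_unique2)
  qed
  have F_super: "F A + F B \<le> F (A \<union> B)"
    if "A \<in> sets M" "B \<in> sets M" "A \<inter> B = {}" for A B
  proof -
    have one: "ennreal (\<nu> C) + ennreal (\<nu> D) \<le> F (A \<union> B)"
      if "C \<in> sets M" "C \<subseteq> A" "D \<in> sets M" "D \<subseteq> B" for C D
    proof -
      have CD: "\<nu> (C \<union> D) = \<nu> C + \<nu> D"
        using that \<open>A \<inter> B = {}\<close> by (intro fin_add) auto
      have 1: "ennreal (\<nu> C) \<le> F (A \<union> B)" using that by (intro ub) auto
      have 2: "ennreal (\<nu> D) \<le> F (A \<union> B)" using that by (intro ub) auto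
      have 3: "ennreal (\<nu> C + \<nu> D) \<le> F (A \<union> B)"
        unfolding CD[symmetric] using that by (intro ub) auto
      show ?thesis
        using 1 2 3 by (cases "\<nu> C \<ge> 0"; cases "\<nu> D \<ge> 0")
          (auto simp: ennreal_plus[symmetric] ennreal_neg simp del: ennreal_plus)
    qed
    have step: "ennreal (\<nu> C) + F B \<le> F (A \<union> B)" if "C \<in> sets M" "C \<subseteq> A" for C
    proof -
      have "ennreal (\<nu> C) + F B =
          (SUP D \<in> {D \<in> sets M. D \<subseteq> B}. ennreal (\<nu> C) + ennreal (\<nu> D))"
        unfolding F_def by (subst ennreal_SUP_add_right) auto
      also have "\<dots> \<le> F (A \<union> B)"
        using one that by (intro SUP_least) auto
      finally show ?thesis .
    qed
    have "F A + F B = (SUP C \<in> {C \<in> sets M. C \<subseteq> A}. ennreal (\<nu> C) + F B)"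
      unfolding F_def[of A] by (subst ennreal_SUP_add_left) auto
    also have "\<dots> \<le> F (A \<union> B)"
      using step by (intro SUP_least) auto
    finally show ?thesis .
  qed
  have F_mono: "F A \<le> F B" if "A \<subseteq> B" for A B
    unfolding F_def using that by (intro SUP_subset_mono) auto
  have "countably_additive (sets M) F"
  proof (rule countably_additiveI)
    fix A :: "nat \<Rightarrow> 'a set"
    assume A: "range A \<subseteq> sets M" "disjoint_family A" "(\<Union>i. A i) \<in> sets M"
    have As: "A i \<in> sets M" for i using A by auto
    have part: "(\<Sum>i<n. F (A i)) \<le> F (\<Union>i<n. A i)" for n
    proof (induction n)
      case (Suc n)
      have "(\<Sum>i<Suc n. F (A i)) \<le> F (\<Union>i<n. A i) + F (A n)"
        using Suc by (auto intro: add_right_mono)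
      also have "\<dots> \<le> F ((\<Union>i<n. A i) \<union> A n)"
      proof (intro F_super)
        have "A i \<inter> A n = {}" if "i < n" for i
          using A(2) that by (auto simp: disjoint_family_on_def)
        then show "(\<Union>i<n. A i) \<inter> A n = {}" by blast
      qed (use As in auto)
      finally show ?case by (simp add: lessThan_Suc Un_commute)
    qed simp
    have "(\<Sum>i. F (A i)) \<le> F (\<Union>i. A i)"
      by (intro suminf_le_const) (auto intro!: order_trans[OF part] F_mono)
    moreover have "F (\<Union>i. A i) \<le> (\<Sum>i. F (A i))"
      unfolding F_def[of "\<Union>i. A i"]
    proof (intro SUP_least, safe)
      fix B assume B: "B \<in> sets M" "B \<subseteq> (\<Union>i. A i)"
      have "(\<lambda>i. \<nu> (B \<inter> A i)) sums \<nu> (\<Union>i. B \<inter> A i)"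
        using A(2) As B(1) by (intro add) (auto simp: disjoint_family_on_def)
      moreover have "(\<Union>i. B \<inter> A i) = B" using B by auto
      ultimately have "(\<lambda>n. \<Sum>i<n. \<nu> (B \<inter> A i)) \<longlonglongrightarrow> \<nu> B"
        by (simp add: sums_def)
      then have lim: "(\<lambda>n. ennreal (\<Sum>i<n. \<nu> (B \<inter> A i))) \<longlonglongrightarrow> ennreal (\<nu> B)"
        by (rule tendsto_ennrealI)
      have "ennreal (\<Sum>i<n. \<nu> (B \<inter> A i)) \<le> (\<Sum>i. F (A i))" for n
      proof -
        have "ennreal (\<Sum>i<n. \<nu> (B \<inter> A i)) \<le> ennreal (\<Sum>i<n. max 0 (\<nu> (B \<inter> A i)))"
          by (intro ennreal_leI sum_mono) auto
        also have "\<dots> = (\<Sum>i<n. ennreal (max 0 (\<nu> (B \<inter> A i))))"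
          by (subst sum_ennreal) auto
        also have "\<dots> \<le> (\<Sum>i<n. F (A i))"
        proof (intro sum_mono)
          fix i
          show "ennreal (max 0 (\<nu> (B \<inter> A i))) \<le> F (A i)"
            using ub[of "B \<inter> A i" "A i"] B(1) As by (auto simp: max_def)
        qed
        also have "\<dots> \<le> (\<Sum>i. F (A i))"
          by (intro sum_le_suminf) auto
        finally show ?thesis .
      qed
      then show "ennreal (\<nu> B) \<le> (\<Sum>i. F (A i))"
        by (intro LIMSEQ_le_const2[OF lim]) auto
    qed
    ultimately show "(\<Sum>i. F (A i)) = F (\<Union>i. A i)" by simp
  qed
  moreover have "positive (sets M) F"
    by (auto simp: positive_def F_def empty cong: conj_cong)
  ultimately show ?thesis
    using X unfolding pos_variation_def F_def[abs_def]
    by (intro emeasure_measure_of_sigma[OF sets.sigma_algebra_axioms]) auto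
qed


section \<open>Fourier transform\<close>

definition fourier_transform ::
    "((real \<times> real) set \<Rightarrow> complex) \<Rightarrow> real \<times> real \<Rightarrow> complex" where
  "fourier_transform \<mu> \<xi> =
     complex_measure_integral borel \<mu> (\<lambda>x. exp (\<i> * complex_of_real pi * complex_of_real (x \<bullet> \<xi>)))"


section \<open>The hyperbola and its arc length measure\<close>

definition hyperbola :: "real \<Rightarrow> (real \<times> real) set" where
  "hyperbola M = {(x1, x2). x1 * x2 = M\<^sup>2 / (4 * pi\<^sup>2)}"

text \<open>
  Arc length measure on the image of a \<open>C\<^sup>1\<close> curve \<open>g\<close> that is injective on the open parameter
  set \<open>S\<close>: the push-forward of \<open>|g'(t)| dt\<close>.
\<close>

definition arc_length_measure ::
    "(real \<Rightarrow> 'a :: {real_normed_vector, second_countable_topology}) \<Rightarrow> real set \<Rightarrow> 'a measure" where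
  "arc_length_measure g S =
     distr (density (restrict_space lborel S) (\<lambda>t. ennreal (norm (vector_derivative g (at t)))))
       borel g"

text \<open>Both branches of the hyperbola are parametrized at once by their first coordinate.\<close>

definition hyperbola_arc_length :: "real \<Rightarrow> (real \<times> real) measure" where
  "hyperbola_arc_length M = arc_length_measure (\<lambda>t. (t, M\<^sup>2 / (4 * pi\<^sup>2 * t))) (- {0})"

text \<open>
  Since the hyperbola is closed, being supported on it means vanishing on every Borel set
  disjoint from it.
\<close>

definition AC :: "real \<Rightarrow> ((real \<times> real) set \<Rightarrow> complex) set" where
  "AC M = {\<mu>. complex_measure borel \<mu>
            \<and> (\<forall>A \<in> sets borel. A \<inter> hyperbola M = {} \<longrightarrow> \<mu> A = 0)
            \<and> (\<forall>A \<in> sets borel. emeasure (hyperbola_arc_length M) A = 0 \<longrightarrow> \<mu> A = 0)}"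


section \<open>Zariski closure\<close>

definition zclos :: "real \<Rightarrow> (real \<times> real) set \<Rightarrow> (real \<times> real) set" where
  "zclos M \<Lambda> = {\<xi>. \<forall>\<mu> \<in> AC M. (\<forall>\<eta> \<in> \<Lambda>. fourier_transform \<mu> \<eta> = 0) \<longrightarrow> fourier_transform \<mu> \<xi> = 0}"

end

theory Submission
  imports Defs "HOL-Complex_Analysis.Cauchy_Integral_Formula" "HOL-Probability.Sinc_Integral"
begin

text \<open>
  An element of \<open>AC M\<close> is a density \<open>f \<in> L\<^sup>1(\<real>)\<close> in the coordinate \<open>t = x\<^sub>1\<close>, and its
  Fourier transform pairs \<open>f\<close> with \<open>exp (\<i> (a t - b / t))\<close>.

  \<^item> If \<open>f\<close> is orthogonal to \<open>exp (\<i> s t)\<close> for all \<open>s > 0\<close>, then it is orthogonal to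
    \<open>exp (\<i> s t) G (q exp (\<i> \<delta> t))\<close> for every \<open>G\<close> holomorphic in the unit disc and \<open>0 < q < 1\<close>, by
    expanding \<open>G\<close>.  Taking \<open>G z = exp (- \<tau> \<delta> / (1 - z))\<close>, which is bounded by 1, and
    \<open>q = exp (- \<delta>\<^sup>2)\<close>, the limit \<open>\<delta> \<rightarrow> 0\<close> gives \<open>exp (\<i> (s t - \<tau> / t))\<close>.  So vanishing on a
    semi-axis spreads to the closed quadrant.

  \<^item> For a point outside the quadrant, let \<open>g t = t\<close>, \<open>w t = 1 / t\<^sup>2\<close> or \<open>g t = - 1 / t\<close>, \<open>w t = 1\<close>.
    By scaling, \<open>\<integral> (1 - cos (a g)) w\<close> is a positive multiple of \<open>\<bar>a\<bar>\<close>, hence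
    \<open>f = exp (\<i> r g) (exp (\<i> \<delta> g) - 1)\<^sup>2 w\<close> with \<open>r \<ge> 0\<close> annihilates all \<open>exp (\<i> s g)\<close>,
    \<open>s \<ge> 0\<close>.  Its pairing with \<open>exp (- \<i> (r + \<delta>) g)\<close> times a unimodular factor is that factor
    integrated against \<open>- 2 (1 - cos (\<delta> g)) w\<close>, which after rescaling is nonzero for small \<open>\<delta>\<close>.
\<close>

section \<open>Jordan parts of a complex measure\<close>

text \<open>Exhaustion argument: a set of infinite variation contains a smaller one of infinite
  variation such that the discarded piece has \<open>\<bar>\<nu>\<bar>\<close> at least 1. Iterating
  yields disjoint pieces whose values would have to form a convergent series without tending to
  0.\<close>

lemma finite_pos_variation:
  assumes add: "\<And>A :: nat \<Rightarrow> 'a set. range A \<subseteq> sets M \<Longrightarrow> disjoint_family A \<Longrightarrow>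
                  (\<lambda>i. \<nu> (A i)) sums \<nu> (\<Union>i. A i)"
  shows "finite_measure (pos_variation M \<nu>)"
proof (rule finite_measureI, rule notI)
  define P where "P = pos_variation M \<nu>"
  have P_eq: "emeasure P X = (SUP B \<in> {B \<in> sets M. B \<subseteq> X}. ennreal (\<nu> B))" if "X \<in> sets M" for X
    using emeasure_pos_variation[OF add that] by (simp add: P_def)
  have sets_P: "sets P = sets M" and space_P: "space P = space M"
    by (auto simp: P_def pos_variation_def sets.space_closed sets.sigma_sets_eq)
  have "(\<lambda>i::nat. \<nu> {}) sums \<nu> {}"
    using add[of "\<lambda>_. {}"] by (simp add: disjoint_family_on_def)
  then have empty: "\<nu> {} = 0"
    using summable_LIMSEQ_zero[of "\<lambda>i::nat. \<nu> {}"] by (auto simp: sums_iff LIMSEQ_const_iff)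
  have fin_add: "\<nu> (A \<union> B) = \<nu> A + \<nu> B"
    if "A \<in> sets M" "B \<in> sets M" "A \<inter> B = {}" for A B
  proof -
    have "(\<lambda>i. \<nu> (binaryset A B i)) sums \<nu> (\<Union>i. binaryset A B i)"
      using that by (intro add)
        (auto simp: range_binaryset_eq disjoint_family_on_def binaryset_def)
    moreover have "(\<lambda>i. \<nu> (binaryset A B i)) sums (\<nu> A + \<nu> B)"
      using binaryset_sums[of \<nu> A B] empty by simp
    ultimately show ?thesis
      by (metis UN_binaryset_eq sums_unique2)
  qed
  have split: "\<exists>B. (B \<in> sets M \<and> emeasure P B = \<infinity>) \<and> B \<subseteq> A \<and> 1 \<le> \<bar>\<nu> (A - B)\<bar>"
    if A: "A \<in> sets M" "emeasure P A = \<infinity>" for A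
  proof -
    \<comment> \<open>The threshold exceeds \<open>\<bar>\<nu> A\<bar>\<close> by 1 so that both
      \<open>C\<close> and \<open>A - C\<close> get absolute value at least 1: whichever of the two
      has infinite variation can be kept and the other discarded.\<close>
    have "ennreal (\<bar>\<nu> A\<bar> + 1) < (SUP B \<in> {B \<in> sets M. B \<subseteq> A}. ennreal (\<nu> B))"
      unfolding P_eq[OF A(1), symmetric] A(2) by simp
    then obtain C where C: "C \<in> sets M" "C \<subseteq> A" "ennreal (\<bar>\<nu> A\<bar> + 1) < ennreal (\<nu> C)"
      unfolding less_SUP_iff by blast
    then have big: "\<bar>\<nu> A\<bar> + 1 < \<nu> C"
      by (metis ennreal_leI linorder_not_le)
    have "\<nu> A = \<nu> C + \<nu> (A - C)"
      using fin_add[of C "A - C"] C A by (simp add: Un_absorb1)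
    then have D: "1 \<le> \<bar>\<nu> (A - C)\<bar>" "1 \<le> \<bar>\<nu> C\<bar>"
      using big by auto
    have "emeasure P A = emeasure P C + emeasure P (A - C)"
      using C(1,2) A(1) plus_emeasure[of C P "A - C"] by (simp add: sets_P Un_absorb1)
    then consider "emeasure P C = \<infinity>" | "emeasure P (A - C) = \<infinity>"
      using A(2) by (metis ennreal_add_eq_top infinity_ennreal_def)
    then show ?thesis
    proof cases
      case 1
      then show ?thesis using C D by (intro exI[of _ C]) auto
    next
      case 2
      then show ?thesis using C D A by (intro exI[of _ "A - C"]) (auto simp: double_diff)
    qed
  qed
  assume "emeasure (pos_variation M \<nu>) (space (pos_variation M \<nu>)) = \<infinity>"
  then have top: "emeasure P (space M) = \<infinity>"
    by (simp add: P_def[symmetric] space_P)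
  \<comment> \<open>Dependent choice; infinite variation is the invariant that keeps the
    construction going.\<close>
  obtain A where A: "\<And>n. A n \<in> sets M" "\<And>n. A (Suc n) \<subseteq> A n" "\<And>n. 1 \<le> \<bar>\<nu> (A n - A (Suc n))\<bar>"
    using dependent_nat_choice[of "\<lambda>_ B. B \<in> sets M \<and> emeasure P B = \<infinity>"
        "\<lambda>_ A B. B \<subseteq> A \<and> 1 \<le> \<bar>\<nu> (A - B)\<bar>"] split top
    by (metis sets.top)
  have dec: "A n \<subseteq> A m" if "m \<le> n" for m n
    using A(2) that by (rule lift_Suc_antimono_le)
  have "disjoint_family (\<lambda>n. A n - A (Suc n))"
    unfolding disjoint_family_on_def
  proof (intro ballI impI)
    fix m n :: nat
    assume "m \<noteq> n"
    then show "(A m - A (Suc m)) \<inter> (A n - A (Suc n)) = {}"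
      using dec[of "Suc m" n] dec[of "Suc n" m] by (cases m n rule: linorder_cases) auto
  qed
  moreover have "range (\<lambda>n. A n - A (Suc n)) \<subseteq> sets M"
    using A(1) by auto
  ultimately have "summable (\<lambda>n. \<nu> (A n - A (Suc n)))"
    using add sums_summable by blast
  then have "(\<lambda>n. \<bar>\<nu> (A n - A (Suc n))\<bar>) \<longlonglongrightarrow> 0"
    using summable_LIMSEQ_zero tendsto_rabs_zero by blast
  then show False
    using A(3) LIMSEQ_le_const[of "\<lambda>n. \<bar>\<nu> (A n - A (Suc n))\<bar>" 0 1] by auto
qed

text \<open>The four Jordan parts are packed into one indexed family of finite positive measures, so
  that each limit argument is made once for a generic index. They inherit the carrier
  \<open>S\<close> because the supremum over subsets of its complement only sees zeros.\<close>

lemma complex_measure_integral_decomposition: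
  assumes \<mu>: "complex_measure M \<mu>"
    and S: "S \<in> sets M" "\<And>A. A \<in> sets M \<Longrightarrow> A \<inter> S = {} \<Longrightarrow> \<mu> A = 0"
  obtains P :: "nat \<Rightarrow> 'a measure" and c :: "nat \<Rightarrow> complex"
  where "\<And>k. finite_measure (P k)" "\<And>k. sets (P k) = sets M" "\<And>k. AE x in P k. x \<in> S"
    "\<And>f. complex_measure_integral M \<mu> f = (\<Sum>k<4. c k * integral\<^sup>L (P k) f)"
proof -
  define c :: "nat \<Rightarrow> complex" where "c k = [1, -1, \<i>, -\<i>] ! k" for k
  \<comment> \<open>Multiplying by the conjugate of \<open>c k\<close> and taking real parts
    produces Re, -Re, Im, -Im in turn. For k >= 4 the value 0 makes \<open>P k\<close> the null
    measure; these indices do not enter the sum.\<close>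
  define d :: "nat \<Rightarrow> complex" where "d k = (if k < 4 then cnj (c k) else 0)" for k
  define P where "P k = pos_variation M (\<lambda>A. Re (d k * \<mu> A))" for k
  have add: "(\<lambda>i. Re (d k * \<mu> (A i))) sums Re (d k * \<mu> (\<Union>i. A i))"
    if "range A \<subseteq> sets M" "disjoint_family A" for A :: "nat \<Rightarrow> 'a set" and k
    using \<mu> that by (intro sums_Re sums_mult) (auto simp: complex_measure_def)
  have sets_P: "sets (P k) = sets M" for k
    by (auto simp: P_def pos_variation_def sets.space_closed sets.sigma_sets_eq)
  show ?thesis
  proof
    show "finite_measure (P k)" for k
      unfolding P_def by (rule finite_pos_variation[OF add])
    show "sets (P k) = sets M" for k by (rule sets_P)
    show "AE x in P k. x \<in> S" for k
    proof (rule AE_I[where N = "space M - S"])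
      have "ennreal (Re (d k * \<mu> B)) \<le> 0" if "B \<in> sets M" "B \<subseteq> space M - S" for B
        using S(2)[of B] that by (subst S(2)) auto
      then have "emeasure (P k) (space M - S) \<le> 0"
        using S(1) unfolding P_def
        by (subst emeasure_pos_variation[OF add]) (auto intro!: SUP_least simp del: le_zero_eq)
      then show "emeasure (P k) (space M - S) = 0" by simp
    qed (use S sets_eq_imp_space_eq[OF sets_P, of k] in \<open>auto simp: sets_P\<close>)
    show "complex_measure_integral M \<mu> f = (\<Sum>k<4. c k * integral\<^sup>L (P k) f)" for f
      by (simp add: complex_measure_integral_def P_def c_def d_def numeral_eq_Suc algebra_simps)
  qed
qed

section \<open>From positive frequencies to the inner factor\<close>

text \<open>The m-th Taylor term of \<open>G\<close> contributes the frequency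
  \<open>s + m * \<delta>\<close>, which is positive, so \<open>zero\<close> kills it. The factor
  \<open>q\<close> keeps the argument on a circle inside the disc, where absolute convergence gives
  the constant majorant \<open>b\<close>.\<close>

lemma sum_integral_power_series_eq_0:
  fixes P :: "nat \<Rightarrow> 'a measure" and u :: "'a \<Rightarrow> real"
  assumes fin: "\<And>k. finite_measure (P k)" and u [measurable]: "\<And>k. u \<in> borel_measurable (P k)"
    and zero: "\<And>s. s > 0 \<Longrightarrow> (\<Sum>k<n. c k * (\<integral>x. exp (\<i> * complex_of_real (s * u x)) \<partial>P k)) = 0"
    and G: "G holomorphic_on ball 0 1" and s: "0 < s" and \<delta>: "0 \<le> \<delta>" and q: "0 < q" "q < 1"
  shows "(\<Sum>k<n. c k * (\<integral>x. exp (\<i> * complex_of_real (s * u x)) *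
           G (complex_of_real q * exp (\<i> * complex_of_real (\<delta> * u x))) \<partial>P k)) = 0"
proof -
  define a where "a m = (deriv ^^ m) G 0 / fact m" for m
  define w where "w x = complex_of_real q * exp (\<i> * complex_of_real (\<delta> * u x))" for x
  define S where "S N x = exp (\<i> * complex_of_real (s * u x)) * (\<Sum>m<N. a m * w x ^ m)" for N x
  have sums: "(\<lambda>m. a m * z ^ m) sums G z" if "norm z < 1" for z
    using holomorphic_power_series[OF G, of z] that by (simp add: a_def)
  have norm_w: "norm (w x) = q" for x
    using q by (simp add: w_def norm_mult)
  \<comment> \<open>Convergence at the point (1 + q) / 2, strictly between q and 1, forces absolute
    convergence at q.\<close>
  have "summable (\<lambda>m. a m * (complex_of_real ((1 + q) / 2)) ^ m)"
    using q by (intro sums_summable[OF sums]) (auto simp del: of_real_divide of_real_add)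
  then have summ: "summable (\<lambda>m. norm (a m * complex_of_real q ^ m))"
    by (rule powser_insidea) (use q in \<open>auto simp del: of_real_divide of_real_add\<close>)
  define b where "b = (\<Sum>m. norm (a m * complex_of_real q ^ m))"
  have bound: "norm (S N x) \<le> b" for N x
  proof -
    have "norm (S N x) = norm (\<Sum>m<N. a m * w x ^ m)"
      by (simp add: S_def norm_mult)
    also have "\<dots> \<le> (\<Sum>m<N. norm (a m * w x ^ m))"
      by (rule norm_sum)
    also have "\<dots> = (\<Sum>m<N. norm (a m * complex_of_real q ^ m))"
      using q by (simp add: norm_mult norm_power norm_w)
    also have "\<dots> \<le> b"
      unfolding b_def by (intro sum_le_suminf summ) auto
    finally show ?thesis .
  qed
  have S_alt: "S N x = (\<Sum>m<N. a m * complex_of_real q ^ m *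
      exp (\<i> * complex_of_real ((s + real m * \<delta>) * u x)))" for N x
    unfolding S_def w_def sum_distrib_left
    by (intro sum.cong refl)
      (simp add: power_mult_distrib exp_of_nat_mult[symmetric] exp_add[symmetric] algebra_simps)
  have [measurable]: "S N \<in> borel_measurable (P k)" for N k
    unfolding S_alt[abs_def] by measurable
  have lim: "(\<lambda>N. S N x) \<longlonglongrightarrow> exp (\<i> * complex_of_real (s * u x)) * G (w x)" for x
    unfolding S_def using sums[of "w x"] q by (intro tendsto_mult_left) (simp add: sums_def norm_w)
  have [measurable]: "(\<lambda>x. exp (\<i> * complex_of_real (s * u x)) * G (w x)) \<in> borel_measurable (P k)" for k
    by (rule borel_measurable_LIMSEQ_metric[of S]) (measurable, rule lim)
  have conv: "(\<lambda>N. integral\<^sup>L (P k) (S N)) \<longlonglongrightarrow>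
      (\<integral>x. exp (\<i> * complex_of_real (s * u x)) * G (w x) \<partial>P k)" for k
  proof (rule integral_dominated_convergence[where w = "\<lambda>_. b"])
    interpret finite_measure "P k" by (rule fin)
    show "integrable (P k) (\<lambda>_. b)" by simp
  qed (auto simp: bound simp del: of_real_mult intro: lim)
  have "(\<Sum>k<n. c k * integral\<^sup>L (P k) (S N)) = 0" for N
  proof -
    have int: "integrable (P k) (\<lambda>x. exp (\<i> * complex_of_real (r * u x)))" for k r
    proof -
      interpret finite_measure "P k" by (rule fin)
      show ?thesis by (rule integrable_const_bound[where B = 1]) auto
    qed
    have "integral\<^sup>L (P k) (S N) = (\<Sum>m<N. a m * complex_of_real q ^ m *
          (\<integral>x. exp (\<i> * complex_of_real ((s + real m * \<delta>) * u x)) \<partial>P k))" for k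
      unfolding S_alt[abs_def]
      by (subst Bochner_Integration.integral_sum)
        (intro integrable_mult_right int, simp del: of_real_mult of_real_add)
    then have "(\<Sum>k<n. c k * integral\<^sup>L (P k) (S N)) =
        (\<Sum>k<n. \<Sum>m<N. a m * complex_of_real q ^ m *
          (c k * (\<integral>x. exp (\<i> * complex_of_real ((s + real m * \<delta>) * u x)) \<partial>P k)))"
      by (simp add: sum_distrib_left mult.left_commute del: of_real_mult of_real_add)
    also have "\<dots> = (\<Sum>m<N. a m * complex_of_real q ^ m *
          (\<Sum>k<n. c k * (\<integral>x. exp (\<i> * complex_of_real ((s + real m * \<delta>) * u x)) \<partial>P k)))"
      by (subst sum.swap) (simp only: sum_distrib_left)
    also have "\<dots> = 0"
      using s \<delta> by (intro sum.neutral ballI) (subst zero, auto intro!: add_pos_nonneg)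
    finally show ?thesis .
  qed
  moreover have "(\<lambda>N. \<Sum>k<n. c k * integral\<^sup>L (P k) (S N)) \<longlonglongrightarrow>
      (\<Sum>k<n. c k * (\<integral>x. exp (\<i> * complex_of_real (s * u x)) * G (w x) \<partial>P k))"
    by (intro tendsto_sum tendsto_mult_left conv)
  ultimately show ?thesis
    by (simp add: LIMSEQ_const_iff w_def)
qed

text \<open>Up to sign, the expression is the reciprocal of the difference quotient at 0 of
  \<open>g\<close>, whose derivative there is \<open>\<i> * u\<close>. The quadratic term in the
  exponent does not affect this derivative.\<close>

lemma tendsto_resolvent_approximation:
  fixes u :: real
  assumes "u \<noteq> 0"
  shows "((\<lambda>\<delta>. complex_of_real \<delta> / (1 - exp (complex_of_real \<delta> * (\<i> * u - complex_of_real \<delta>)))) \<longlongrightarrow> \<i> / u)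
           (at_right 0)"
proof -
  define g where "g z = exp (z * (\<i> * complex_of_real u - z))" for z :: complex
  have "(g has_field_derivative \<i> * u) (at 0)"
    unfolding g_def by (auto intro!: derivative_eq_intros)
  then have "((\<lambda>z. (g z - g 0) / z) \<longlongrightarrow> \<i> * u) (at 0)"
    by (simp add: DERIV_def)
  moreover have "filterlim complex_of_real (at 0) (at_right 0)"
    by (auto simp: filterlim_at eventually_at_filter intro!: tendsto_eq_intros)
  ultimately have "((\<lambda>\<delta>. (g (complex_of_real \<delta>) - g 0) / complex_of_real \<delta>) \<longlongrightarrow> \<i> * u) (at_right 0)"
    by (rule filterlim_compose)
  then have "((\<lambda>\<delta>. - inverse ((g (complex_of_real \<delta>) - g 0) / complex_of_real \<delta>)) \<longlongrightarrow>
      - inverse (\<i> * u)) (at_right 0)"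
    using assms by (intro tendsto_minus tendsto_inverse) auto
  moreover have "- inverse ((g z - g 0) / z) = z / (1 - g z)" for z
    by (simp add: g_def minus_divide_right)
  moreover have "- inverse (\<i> * complex_of_real u) = \<i> / u"
    using assms by (simp add: field_simps)
  ultimately show ?thesis
    by (simp add: g_def)
qed

text \<open>The unit disc is mapped into the right half-plane, which is what bounds the exponential
  factor by 1.\<close>

lemma Re_inverse_one_minus_nonneg:
  assumes "norm (w :: complex) < 1"
  shows "0 \<le> Re (1 / (1 - w))"
  using assms complex_Re_le_cmod[of w] by (simp add: Re_divide')

lemma sum_integral_inner_factor_eq_0:
  fixes P :: "nat \<Rightarrow> 'a measure" and u :: "'a \<Rightarrow> real"
  assumes fin: "\<And>k. finite_measure (P k)" and u [measurable]: "\<And>k. u \<in> borel_measurable (P k)"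
    and nz: "\<And>k. AE x in P k. u x \<noteq> 0"
    and zero: "\<And>s. s > 0 \<Longrightarrow> (\<Sum>k<n. c k * (\<integral>x. exp (\<i> * complex_of_real (s * u x)) \<partial>P k)) = 0"
    and s: "0 \<le> s" and \<tau>: "0 \<le> \<tau>"
  shows "(\<Sum>k<n. c k * (\<integral>x. exp (\<i> * complex_of_real (s * u x - \<tau> / u x)) \<partial>P k)) = 0"
proof -
  define \<delta> where "\<delta> m = inverse (real (Suc m))" for m
  have \<delta>_pos: "0 < \<delta> m" for m by (simp add: \<delta>_def)
  have \<delta>_lim: "\<delta> \<longlonglongrightarrow> 0" unfolding \<delta>_def by (rule LIMSEQ_inverse_real_of_nat)
  have \<delta>_right: "filterlim \<delta> (at_right 0) sequentially"
    using \<delta>_lim \<delta>_pos less_imp_neq[OF \<delta>_pos] by (auto simp: filterlim_at intro!: always_eventually)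
  define q where "q m = exp (- (\<delta> m)\<^sup>2)" for m
  have q: "0 < q m" "q m < 1" for m using \<delta>_pos[of m] by (auto simp: q_def)
  define G where "G m z = exp (- complex_of_real \<tau> * (complex_of_real (\<delta> m) / (1 - z)))" for m z
  have G: "G m holomorphic_on ball 0 1" for m
    unfolding G_def by (intro holomorphic_intros) auto
  define w where "w m x = complex_of_real (q m) * exp (\<i> * complex_of_real (\<delta> m * u x))" for m x
  \<comment> \<open>With \<open>q m\<close> equal to the exponential of minus \<delta> squared, the
    argument of \<open>G\<close> takes exactly the shape treated in
    \<open>tendsto_resolvent_approximation\<close>.\<close>
  have w_alt: "w m x = exp (complex_of_real (\<delta> m) * (\<i> * u x - complex_of_real (\<delta> m)))" for m x
    by (simp add: w_def q_def exp_of_real[symmetric] exp_add[symmetric] power2_eq_square algebra_simps)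
  have norm_w: "norm (w m x) < 1" for m x
    using q[of m] by (simp add: w_def norm_mult)
  \<comment> \<open>The frequency is shifted to \<open>s + \<delta> m\<close>, which is strictly
    positive even when s = 0; the shift disappears in the limit.\<close>
  define F where "F m x = exp (\<i> * complex_of_real ((s + \<delta> m) * u x)) * G m (w m x)" for m x
  have F0: "(\<Sum>k<n. c k * integral\<^sup>L (P k) (F m)) = 0" for m
    unfolding F_def w_def
    using s \<delta>_pos[of m] q[of m] by (intro sum_integral_power_series_eq_0[OF fin u zero G]) auto
  have [measurable]: "F m \<in> borel_measurable (P k)" for m k
    unfolding F_def G_def w_def by measurable
  have bound: "norm (F m x) \<le> 1" for m x
  proof -
    have "Re (complex_of_real \<tau> * (complex_of_real (\<delta> m) / (1 - w m x))) =
        \<tau> * \<delta> m * Re (1 / (1 - w m x))"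
      by (simp add: Re_divide)
    also have "\<dots> \<ge> 0"
      using \<tau> \<delta>_pos[of m] Re_inverse_one_minus_nonneg[OF norm_w] by (intro mult_nonneg_nonneg) auto
    finally show ?thesis
      by (simp add: F_def G_def norm_mult)
  qed
  have lim: "(\<lambda>m. F m x) \<longlonglongrightarrow> exp (\<i> * complex_of_real (s * u x - \<tau> / u x))" if "u x \<noteq> 0" for x
  proof -
    have l: "(\<lambda>m. complex_of_real (\<delta> m) / (1 - w m x)) \<longlonglongrightarrow> \<i> / u x"
      unfolding w_alt
      using filterlim_compose[OF tendsto_resolvent_approximation[OF that] \<delta>_right] by simp
    have "(\<lambda>m. F m x) \<longlonglongrightarrow> exp (\<i> * complex_of_real ((s + 0) * u x)) *
        exp (- complex_of_real \<tau> * (\<i> / u x))"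
      unfolding F_def G_def
      by (intro tendsto_mult tendsto_exp tendsto_const tendsto_of_real tendsto_add \<delta>_lim l)
    then show ?thesis
      by (simp add: exp_add[symmetric] algebra_simps)
  qed
  have "(\<lambda>m. integral\<^sup>L (P k) (F m)) \<longlonglongrightarrow>
      (\<integral>x. exp (\<i> * complex_of_real (s * u x - \<tau> / u x)) \<partial>P k)" for k
  proof (rule integral_dominated_convergence[where w = "\<lambda>_. 1"])
    interpret finite_measure "P k" by (rule fin)
    show "integrable (P k) (\<lambda>_. 1 :: real)" by simp
    show "AE x in P k. (\<lambda>m. F m x) \<longlonglongrightarrow> exp (\<i> * complex_of_real (s * u x - \<tau> / u x))"
      using nz[of k] by eventually_elim (rule lim)
  qed (auto simp: bound)
  then have "(\<lambda>m. \<Sum>k<n. c k * integral\<^sup>L (P k) (F m)) \<longlonglongrightarrow>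
      (\<Sum>k<n. c k * (\<integral>x. exp (\<i> * complex_of_real (s * u x - \<tau> / u x)) \<partial>P k))"
    by (intro tendsto_sum tendsto_mult_left)
  then show ?thesis
    by (simp add: F0 LIMSEQ_const_iff)
qed

section \<open>Complex measures given by integrable densities\<close>

text \<open>This is the push-forward under \<gamma> of the measure with density \<open>f\<close>.
  The value type is left general to cover a complex density together with its real and imaginary
  parts.\<close>

definition density_image ::
    "'b measure \<Rightarrow> ('b \<Rightarrow> 'a) \<Rightarrow> ('b \<Rightarrow> 'c) \<Rightarrow> 'a set \<Rightarrow> 'c :: {banach, second_countable_topology}" where
  "density_image N \<gamma> f A = (\<integral>t. indicat_real A (\<gamma> t) *\<^sub>R f t \<partial>N)"

text \<open>Dominated convergence with majorant \<open>norm (f t)\<close>: for a disjoint family the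
  partial sums of the indicators stay below 1.\<close>

lemma density_image_sums:
  fixes f :: "'b \<Rightarrow> 'c :: {banach, second_countable_topology}"
  assumes f: "integrable N f" and \<gamma> [measurable]: "\<gamma> \<in> N \<rightarrow>\<^sub>M M"
    and A: "range A \<subseteq> sets M" "disjoint_family A"
  shows "(\<lambda>i. density_image N \<gamma> f (A i)) sums density_image N \<gamma> f (\<Union>i::nat. A i)"
proof -
  have [measurable]: "f \<in> borel_measurable N" using f by auto
  have [measurable]: "A i \<in> sets M" "(\<Union>i. A i) \<in> sets M" for i using A by auto
  define S where "S n t = (\<Sum>i<n. indicat_real (A i) (\<gamma> t))" for n t
  have sums: "(\<lambda>i. indicat_real (A i) x) sums indicat_real (\<Union>i. A i) x" for x
    using A(2) by (intro indicator_sums) (auto simp: disjoint_family_on_def)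
  have S_le: "\<bar>S n t\<bar> \<le> 1" for n t
  proof -
    have "S n t \<le> (\<Sum>i. indicat_real (A i) (\<gamma> t))"
      unfolding S_def using sums[of "\<gamma> t"] by (intro sum_le_suminf) (auto simp: sums_iff)
    also have "\<dots> \<le> 1"
      using sums[of "\<gamma> t"] by (auto simp: sums_iff indicator_def)
    finally show ?thesis
      by (simp add: S_def sum_nonneg)
  qed
  have int: "integrable N (\<lambda>t. indicat_real (A i) (\<gamma> t) *\<^sub>R f t)" for i
    by (rule Bochner_Integration.integrable_bound[OF f]) (auto simp: indicator_def)
  have "(\<lambda>n. \<integral>t. S n t *\<^sub>R f t \<partial>N) \<longlonglongrightarrow> density_image N \<gamma> f (\<Union>i. A i)"
    unfolding density_image_def
  proof (rule integral_dominated_convergence[where w = "\<lambda>t. norm (f t)"])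
    show "AE t in N. (\<lambda>n. S n t *\<^sub>R f t) \<longlonglongrightarrow> indicat_real (\<Union>i. A i) (\<gamma> t) *\<^sub>R f t"
      unfolding S_def using sums by (intro always_eventually allI tendsto_scaleR tendsto_const) (auto simp: sums_def)
    show "AE t in N. norm (S n t *\<^sub>R f t) \<le> norm (f t)" for n
      using S_le by (intro always_eventually allI) (auto intro: mult_left_le_one_le)
    show "(\<lambda>t. indicat_real (\<Union>i. A i) (\<gamma> t) *\<^sub>R f t) \<in> borel_measurable N"
      by measurable
  qed (use f in \<open>auto simp: S_def\<close>)
  moreover have "(\<integral>t. S n t *\<^sub>R f t \<partial>N) = (\<Sum>i<n. density_image N \<gamma> f (A i))" for n
    unfolding S_def scaleR_sum_left density_image_def by (rule Bochner_Integration.integral_sum[OF int])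
  ultimately show ?thesis
    by (simp add: sums_def)
qed

text \<open>The supremum over the subsets of \<open>A\<close> is attained on the part of \<open>A\<close> where the density is
  positive; the left inverse \<open>p\<close> of \<open>\<gamma>\<close> makes this part the image of a measurable set.\<close>

lemma pos_variation_density_image:
  fixes h :: "'b \<Rightarrow> real"
  assumes h: "integrable N h" and \<gamma> [measurable]: "\<gamma> \<in> N \<rightarrow>\<^sub>M M" and p [measurable]: "p \<in> M \<rightarrow>\<^sub>M N"
    and p_\<gamma>: "\<And>t. t \<in> space N \<Longrightarrow> p (\<gamma> t) = t"
  shows "pos_variation M (density_image N \<gamma> h) = distr (density N (\<lambda>t. ennreal (h t))) M \<gamma>"
proof (rule measure_eqI)
  have [measurable]: "h \<in> borel_measurable N" using h by auto
  have sets_eq: "sets (pos_variation M (density_image N \<gamma> h)) = sets M"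
    by (auto simp: pos_variation_def sets.space_closed sets.sigma_sets_eq)
  then show "sets (pos_variation M (density_image N \<gamma> h)) = sets (distr (density N (\<lambda>t. ennreal (h t))) M \<gamma>)"
    by simp
  fix A assume "A \<in> sets (pos_variation M (density_image N \<gamma> h))"
  then have A [measurable]: "A \<in> sets M" by (simp add: sets_eq)
  define J where "J B = (\<integral>\<^sup>+t. ennreal (h t) * indicator B (\<gamma> t) \<partial>N)" for B
  have RHS: "emeasure (distr (density N (\<lambda>t. ennreal (h t))) M \<gamma>) A = J A"
    unfolding J_def
    by (subst emeasure_distr, measurable, subst emeasure_density, measurable)
       (auto intro!: nn_integral_cong simp: indicator_def)
  have int: "integrable N (\<lambda>t. indicat_real B (\<gamma> t) * h t)" if [measurable]: "B \<in> sets M" for B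
    by (rule Bochner_Integration.integrable_bound[OF h]) (auto simp: indicator_def)
  have "(SUP B \<in> {B \<in> sets M. B \<subseteq> A}. ennreal (density_image N \<gamma> h B)) = J A"
  proof (rule antisym)
    show "(SUP B \<in> {B \<in> sets M. B \<subseteq> A}. ennreal (density_image N \<gamma> h B)) \<le> J A"
    proof (rule SUP_least)
      fix B assume B: "B \<in> {B \<in> sets M. B \<subseteq> A}"
      then have [measurable]: "B \<in> sets M" by simp
      have "density_image N \<gamma> h B \<le> (\<integral>t. indicat_real B (\<gamma> t) * max 0 (h t) \<partial>N)"
        unfolding density_image_def real_scaleR_def
        by (intro integral_mono int Bochner_Integration.integrable_bound[OF h])
           (auto simp: indicator_def)
      then have "ennreal (density_image N \<gamma> h B) \<le> ennreal (\<integral>t. indicat_real B (\<gamma> t) * max 0 (h t) \<partial>N)"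
        by (rule ennreal_leI)
      also have "\<dots> = (\<integral>\<^sup>+t. ennreal (indicat_real B (\<gamma> t) * max 0 (h t)) \<partial>N)"
        by (intro nn_integral_eq_integral[symmetric] Bochner_Integration.integrable_bound[OF h])
           (auto simp: indicator_def)
      also have "\<dots> \<le> J A"
        unfolding J_def using B by (intro nn_integral_mono) (auto simp: indicator_def max_def ennreal_neg)
      finally show "ennreal (density_image N \<gamma> h B) \<le> J A" .
    qed
    define B where "B = {x \<in> space M. x \<in> A \<and> 0 < h (p x)}"
    have [measurable]: "B \<in> sets M" unfolding B_def by measurable
    have B: "B \<in> sets M" "B \<subseteq> A" by (auto simp: B_def)
    have B_iff: "\<gamma> t \<in> B \<longleftrightarrow> \<gamma> t \<in> A \<and> 0 < h t" if "t \<in> space N" for t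
      using that measurable_space[OF \<gamma> that] by (simp add: B_def p_\<gamma>)
    have "J A = (\<integral>\<^sup>+t. ennreal (indicat_real B (\<gamma> t) * h t) \<partial>N)"
      unfolding J_def by (intro nn_integral_cong) (auto simp: indicator_def B_iff ennreal_neg)
    also have "\<dots> = ennreal (density_image N \<gamma> h B)"
      unfolding density_image_def real_scaleR_def
      by (intro nn_integral_eq_integral int AE_I2) (auto simp: indicator_def B_iff)
    finally show "J A \<le> (SUP B \<in> {B \<in> sets M. B \<subseteq> A}. ennreal (density_image N \<gamma> h B))"
      using B by (auto intro: SUP_upper)
  qed
  then show "emeasure (pos_variation M (density_image N \<gamma> h)) A =
      emeasure (distr (density N (\<lambda>t. ennreal (h t))) M \<gamma>) A"
    unfolding RHS by (subst emeasure_pos_variation[OF density_image_sums[OF h \<gamma>]]) auto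
qed

lemma pos_variation_cong:
  assumes "\<And>A. A \<in> sets M \<Longrightarrow> \<nu> A = \<nu>' A"
  shows "pos_variation M \<nu> = pos_variation M \<nu>'"
proof -
  have "(SUP B \<in> {B \<in> sets M. B \<subseteq> A}. ennreal (\<nu> B)) = (SUP B \<in> {B \<in> sets M. B \<subseteq> A}. ennreal (\<nu>' B))" for A
    using assms by (intro SUP_cong) auto
  then show ?thesis
    by (simp add: pos_variation_def)
qed

text \<open>The Jordan parts of a real density \<open>h\<close> are the images of
  \<open>max 0 h\<close> and \<open>max 0 (- h)\<close>, whose difference is \<open>h\<close>; real
  and imaginary parts are then recombined. Boundedness of \<open>g\<close> makes all the integrals
  split.\<close>

lemma complex_measure_integral_density_image:
  fixes f :: "'b \<Rightarrow> complex"
  assumes f: "integrable N f" and \<gamma> [measurable]: "\<gamma> \<in> N \<rightarrow>\<^sub>M M" and p: "p \<in> M \<rightarrow>\<^sub>M N"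
    and p_\<gamma>: "\<And>t. t \<in> space N \<Longrightarrow> p (\<gamma> t) = t"
    and g [measurable]: "g \<in> borel_measurable M" and bound: "\<And>x. norm (g x) \<le> 1"
  shows "complex_measure_integral M (density_image N \<gamma> f) g = (\<integral>t. g (\<gamma> t) * f t \<partial>N)"
proof -
  have [measurable]: "f \<in> borel_measurable N" using f by auto
  define K where "K h = (\<integral>t. complex_of_real (h t) * g (\<gamma> t) \<partial>N)" for h
  have int: "integrable N (\<lambda>t. complex_of_real (h t) * g (\<gamma> t))" if "integrable N h" for h
    by (rule Bochner_Integration.integrable_bound[OF that])
       (use bound that in \<open>auto simp: norm_mult intro!: AE_I2 mult_left_le\<close>)
  have pos: "integral\<^sup>L (pos_variation M (density_image N \<gamma> h)) g = K (\<lambda>t. max 0 (h t))"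
    if h: "integrable N h" for h
  proof -
    have [measurable]: "h \<in> borel_measurable N" using h by auto
    have "density N (\<lambda>t. ennreal (h t)) = density N (\<lambda>t. ennreal (max 0 (h t)))"
      by (intro density_cong) (auto simp: max_def ennreal_neg)
    then have "pos_variation M (density_image N \<gamma> h) = distr (density N (\<lambda>t. ennreal (max 0 (h t)))) M \<gamma>"
      by (simp only: pos_variation_density_image[OF h \<gamma> p p_\<gamma>])
    then show ?thesis
      by (simp only:) (subst integral_distr, measurable, subst integral_density,
          auto simp: K_def scaleR_conv_of_real)
  qed
  have diff: "integral\<^sup>L (pos_variation M (density_image N \<gamma> h)) g -
      integral\<^sup>L (pos_variation M (\<lambda>A. - density_image N \<gamma> h A)) g = K h" if h: "integrable N h" for h
  proof -
    have "(\<lambda>A. - density_image N \<gamma> h A) = density_image N \<gamma> (\<lambda>t. - h t)"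
      by (simp add: density_image_def fun_eq_iff)
    then show ?thesis
      using h unfolding pos[OF h] K_def
      by (simp add: pos K_def Bochner_Integration.integral_diff[symmetric] int
          left_diff_distrib[symmetric] of_real_diff[symmetric] del: of_real_diff Bochner_Integration.integral_diff)
         (intro Bochner_Integration.integral_cong refl, auto simp: max_def)
  qed
  have indf: "integrable N (\<lambda>t. indicat_real A (\<gamma> t) *\<^sub>R f t)" if [measurable]: "A \<in> sets M" for A
    by (rule Bochner_Integration.integrable_bound[OF f]) (auto simp: indicator_def)
  have ReIm: "Re (density_image N \<gamma> f A) = density_image N \<gamma> (\<lambda>t. Re (f t)) A"
      "Im (density_image N \<gamma> f A) = density_image N \<gamma> (\<lambda>t. Im (f t)) A" if "A \<in> sets M" for A
    using integral_Re[OF indf[OF that]] integral_Im[OF indf[OF that]]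
    by (simp_all add: density_image_def)
  have parts: "integrable N (\<lambda>t. Re (f t))" "integrable N (\<lambda>t. Im (f t))"
    using f by auto
  have "complex_measure_integral M (density_image N \<gamma> f) g = K (\<lambda>t. Re (f t)) + \<i> * K (\<lambda>t. Im (f t))"
    unfolding complex_measure_integral_def
    by (simp add: diff[OF parts(1), symmetric] diff[OF parts(2), symmetric] ReIm cong: pos_variation_cong)
  also have "\<dots> = (\<integral>t. complex_of_real (Re (f t)) * g (\<gamma> t) + \<i> * (complex_of_real (Im (f t)) * g (\<gamma> t)) \<partial>N)"
    using int[OF parts(1)] int[OF parts(2)] by (simp add: K_def)
  also have "\<dots> = (\<integral>t. g (\<gamma> t) * f t \<partial>N)"
    by (intro Bochner_Integration.integral_cong refl) (simp add: complex_eq_iff algebra_simps)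
  finally show ?thesis .
qed

section \<open>The kernels built from 1 - cos\<close>

lemma one_minus_cos_le: "1 - cos x \<le> x\<^sup>2 / 2" for x :: real
proof -
  have "(sin (x / 2))\<^sup>2 \<le> (x / 2)\<^sup>2"
    using power_mono[OF abs_sin_x_le_abs_x[of "x / 2"], of 2] by (simp add: power_divide)
  then show ?thesis
    using cos_double_sin[of "x / 2"] by (simp add: power_divide)
qed

text \<open>One integrable majorant serves both kernels. The quadratic bound on 1 - cos controls the
  first near 0 and the second near infinity; the trivial bound 2 covers the rest.\<close>

lemma one_minus_cos_bounds:
  fixes t :: real
  shows "(1 - cos t) / t\<^sup>2 \<le> 4 * inverse (1 + t\<^sup>2)" "1 - cos (1 / t) \<le> 4 * inverse (1 + t\<^sup>2)"
proof -
  have pos: "0 < 1 + t\<^sup>2" by (simp add: add_pos_nonneg)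
  show "(1 - cos t) / t\<^sup>2 \<le> 4 * inverse (1 + t\<^sup>2)"
  proof (cases "t = 0")
    case False
    have "(1 - cos t) * (1 + t\<^sup>2) = (1 - cos t) + (1 - cos t) * t\<^sup>2"
      by (simp add: algebra_simps)
    also have "\<dots> \<le> t\<^sup>2 / 2 + 2 * t\<^sup>2"
      using one_minus_cos_le[of t] cos_ge_minus_one[of t]
      by (intro add_mono mult_right_mono) (auto simp del: cos_ge_minus_one)
    also have "\<dots> \<le> 4 * t\<^sup>2" by simp
    finally show ?thesis
      using False pos by (simp add: divide_simps)
  qed simp
  show "1 - cos (1 / t) \<le> 4 * inverse (1 + t\<^sup>2)"
  proof (cases "t = 0")
    case False
    have "(1 - cos (1 / t)) * (1 + t\<^sup>2) = (1 - cos (1 / t)) + (1 - cos (1 / t)) * t\<^sup>2"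
      by (simp add: algebra_simps)
    also have "\<dots> \<le> 2 + ((1 / t)\<^sup>2 / 2) * t\<^sup>2"
      using one_minus_cos_le[of "1 / t"] cos_ge_minus_one[of "1 / t"]
      by (intro add_mono mult_right_mono) (auto simp del: cos_ge_minus_one)
    also have "\<dots> \<le> 4" using False by (simp add: power_divide)
    finally show ?thesis
      using pos by (simp add: divide_simps)
  qed simp
qed

lemma integrable_one_minus_cos:
  "integrable lborel (\<lambda>t. (1 - cos t) / t\<^sup>2 :: real)"
  "integrable lborel (\<lambda>t. 1 - cos (1 / t) :: real)"
proof -
  have int: "integrable lborel (\<lambda>t. 4 * inverse (1 + t\<^sup>2) :: real)"
    using integrable_inverse_1_plus_square by (simp add: set_integrable_def)
  have "0 \<le> 4 * inverse (1 + t\<^sup>2)" for t :: real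
    by simp
  then show "integrable lborel (\<lambda>t. (1 - cos t) / t\<^sup>2 :: real)"
      "integrable lborel (\<lambda>t. 1 - cos (1 / t) :: real)"
    using one_minus_cos_bounds
    by (auto intro!: Bochner_Integration.integrable_bound[OF int] AE_I2)
qed

lemma integral_pos_if_pos_on_interval:
  fixes K :: "real \<Rightarrow> real"
  assumes K: "integrable lborel K" "\<And>t. 0 \<le> K t" and pos: "\<And>t. a \<le> t \<Longrightarrow> t \<le> b \<Longrightarrow> 0 < K t"
    and "a < b"
  shows "0 < integral\<^sup>L lborel K"
proof (rule ccontr)
  assume "\<not> 0 < integral\<^sup>L lborel K"
  moreover have "0 \<le> integral\<^sup>L lborel K"
    by (rule integral_nonneg_AE) (use K(2) in auto)
  ultimately have "integral\<^sup>L lborel K = 0"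
    by simp
  then have "AE t in lborel. K t = 0"
    using integral_nonneg_eq_0_iff_AE[OF K(1)] K(2) by simp
  then have "AE t in lborel. t \<notin> {a..b}"
    by eventually_elim (use pos in force)
  then have "emeasure lborel {a..b} = 0"
    by (subst (asm) AE_iff_measurable[of "{a..b}"]) auto
  then show False
    using \<open>a < b\<close> by simp
qed

lemma cos_less_one: "0 < x \<Longrightarrow> x \<le> 2 \<Longrightarrow> cos x < 1" for x :: real
  using cos_monotone_0_pi[of 0 x] pi_ge_two by simp

lemma integral_one_minus_cos_pos:
  "0 < (\<integral>t. (1 - cos (t :: real)) / t\<^sup>2 \<partial>lborel)"
  "0 < (\<integral>t. 1 - cos (1 / t :: real) \<partial>lborel)"
proof -
  \<comment> \<open>For t in [1, 2] both \<open>t\<close> and \<open>1 / t\<close> lie in (0, 2],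
    where the cosine stays below 1.\<close>
  show "0 < (\<integral>t. (1 - cos (t :: real)) / t\<^sup>2 \<partial>lborel)"
    by (rule integral_pos_if_pos_on_interval[where a = 1 and b = 2])
      (auto intro!: integrable_one_minus_cos cos_less_one divide_pos_pos)
  show "0 < (\<integral>t. 1 - cos (1 / t :: real) \<partial>lborel)"
    by (rule integral_pos_if_pos_on_interval[where a = 1 and b = 2])
      (auto intro!: integrable_one_minus_cos cos_less_one simp: field_simps)
qed

text \<open>Substitution of \<open>a * t\<close>, respectively \<open>t / a\<close>, shows that the
  integral is linear in \<open>a\<close>. Both claims have the form
  \<open>(1 - cos (a * g t)) * w t\<close>, whence the factor 1 and the argument
  \<open>- 1 / t\<close> in the second.\<close>

lemma has_integral_one_minus_cos_scaled:
  fixes a :: real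
  assumes "0 \<le> a"
  shows "has_bochner_integral lborel (\<lambda>t. (1 - cos (a * t)) * (1 / t\<^sup>2)) ((\<integral>t. (1 - cos t) / t\<^sup>2 \<partial>lborel) * a)"
    and "has_bochner_integral lborel (\<lambda>t. (1 - cos (a * (- 1 / t))) * 1) ((\<integral>t. 1 - cos (1 / t) \<partial>lborel) * a)"
proof -
  show "has_bochner_integral lborel (\<lambda>t. (1 - cos (a * t)) * (1 / t\<^sup>2)) ((\<integral>t. (1 - cos t) / t\<^sup>2 \<partial>lborel) * a)"
  proof (cases "a = 0")
    case False
    \<comment> \<open>The squared factor undoes the denominator after substitution; with the
      Jacobian \<open>1 / \<bar>a\<bar>\<close> it leaves one power of \<open>a\<close>. The summand
      0 fits the affine substitution rule.\<close>
    have scaled: "has_bochner_integral lborel (\<lambda>t. a\<^sup>2 * ((1 - cos (0 + a * t)) / (0 + a * t)\<^sup>2))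
       (a\<^sup>2 * ((\<integral>t. (1 - cos t) / t\<^sup>2 \<partial>lborel) /\<^sub>R \<bar>a\<bar>))"
      using False has_bochner_integral_integrable[OF integrable_one_minus_cos(1)]
      by (intro has_bochner_integral_mult_right lborel_has_bochner_integral_real_affine_iff[THEN iffD1]) auto
    have eq: "a\<^sup>2 * ((1 - cos (0 + a * t)) / (0 + a * t)\<^sup>2) = (1 - cos (a * t)) * (1 / t\<^sup>2)" for t
      using False by (simp add: power_mult_distrib)
    have eq': "a\<^sup>2 * (C /\<^sub>R \<bar>a\<bar>) = C * a" for C :: real
      using False assms by (simp add: power2_eq_square)
    show ?thesis
      using scaled unfolding eq eq' .
  qed (simp add: has_bochner_integral_zero)
  show "has_bochner_integral lborel (\<lambda>t. (1 - cos (a * (- 1 / t))) * 1) ((\<integral>t. 1 - cos (1 / t) \<partial>lborel) * a)"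
  proof (cases "a = 0")
    case False
    have "has_bochner_integral lborel (\<lambda>t. 1 - cos (1 / (0 + (1 / a) * t)))
       ((\<integral>t. 1 - cos (1 / t) \<partial>lborel) /\<^sub>R \<bar>1 / a\<bar>)"
      using False has_bochner_integral_integrable[OF integrable_one_minus_cos(2)]
      by (intro lborel_has_bochner_integral_real_affine_iff[THEN iffD1]) auto
    then show ?thesis
      using False assms by (simp add: field_simps)
  qed (simp add: has_bochner_integral_zero)
qed

section \<open>Densities annihilating a half-line of frequencies\<close>

text \<open>By dominated convergence the integrals tend to the positive integral of
  \<open>K\<close>, so they cannot vanish along a whole sequence of \<delta> in (0, a] tending to
  0.\<close>

lemma integral_times_approximate_unit_nonzero:
  fixes K :: "real \<Rightarrow> real" and F :: "real \<Rightarrow> real \<Rightarrow> complex"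
  assumes K: "integrable lborel K" "0 < integral\<^sup>L lborel K"
    and F: "\<And>\<delta>. F \<delta> \<in> borel_measurable lborel" "\<And>\<delta> t. norm (F \<delta> t) \<le> 1"
    and lim: "\<And>t. ((\<lambda>\<delta>. F \<delta> t) \<longlongrightarrow> 1) (at_right 0)" and "0 < a"
  obtains \<delta> where "0 < \<delta>" "\<delta> \<le> a" "(\<integral>t. F \<delta> t * complex_of_real (K t) \<partial>lborel) \<noteq> 0"
proof -
  have [measurable]: "K \<in> borel_measurable lborel" "F \<delta> \<in> borel_measurable lborel" for \<delta> using K F by auto
  define d where "d m = a * inverse (real (Suc m))" for m
  have d: "0 < d m" "d m \<le> a" for m
    using \<open>0 < a\<close> by (auto simp: d_def field_simps)
  have "d \<longlonglongrightarrow> a * 0"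
    unfolding d_def by (intro tendsto_mult_left LIMSEQ_inverse_real_of_nat)
  then have d_lim: "filterlim d (at_right 0) sequentially"
    using d less_imp_neq[OF d(1)] by (auto simp: filterlim_at intro!: always_eventually)
  have "(\<lambda>m. \<integral>t. F (d m) t * complex_of_real (K t) \<partial>lborel) \<longlonglongrightarrow> (\<integral>t. complex_of_real (K t) \<partial>lborel)"
  proof (rule integral_dominated_convergence[where w = "\<lambda>t. norm (K t)"])
    show "AE t in lborel. (\<lambda>m. F (d m) t * complex_of_real (K t)) \<longlonglongrightarrow> complex_of_real (K t)"
      using tendsto_mult_right[OF filterlim_compose[OF lim d_lim]] by (intro AE_I2) fastforce
    show "AE t in lborel. norm (F (d m) t * complex_of_real (K t)) \<le> norm (K t)" for m
      using F(2) by (intro AE_I2) (auto simp: norm_mult intro: mult_left_le_one_le)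
  qed (use K in auto)
  moreover have "(\<integral>t. complex_of_real (K t) \<partial>lborel) \<noteq> 0"
    using K by simp
  ultimately have "\<not> (\<forall>m. (\<integral>t. F (d m) t * complex_of_real (K t) \<partial>lborel) = 0)"
    using LIMSEQ_unique[OF _ tendsto_const] by force
  then show ?thesis
    using that d by blast
qed

text \<open>Since \<open>g\<close> is odd, the integral of the product below is real, and its real part is a second
  difference of \<open>a \<mapsto> \<integral> (1 - cos (a g)) w\<close>, which is linear on \<open>a \<ge> 0\<close>.\<close>

lemma second_difference_transform:
  fixes g w :: "real \<Rightarrow> real"
  assumes [measurable]: "g \<in> borel_measurable borel" "w \<in> borel_measurable borel"
    and odd: "\<And>t. g (- t) = - g t" and even: "\<And>t. w (- t) = w t" and w: "\<And>t. 0 \<le> w t"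
    and I: "\<And>a. 0 \<le> a \<Longrightarrow> has_bochner_integral lborel (\<lambda>t. (1 - cos (a * g t)) * w t) (C * a)"
    and s: "0 \<le> s" and \<delta>: "0 \<le> \<delta>"
  defines "f \<equiv> \<lambda>t. exp (\<i> * complex_of_real (s * g t)) * (exp (\<i> * complex_of_real (\<delta> * g t)) - 1)\<^sup>2 * complex_of_real (w t)"
  shows "integrable lborel f" "integral\<^sup>L lborel f = 0"
proof -
  have sq: "(norm (exp (\<i> * complex_of_real x) - 1))\<^sup>2 = 2 * (1 - cos x)" for x
    by (simp add: cmod_power2 Re_exp Im_exp power2_diff)
  have norm_f: "norm (f t) = 2 * ((1 - cos (\<delta> * g t)) * w t)" for t
    using w[of t] sq[of "\<delta> * g t"] by (simp add: f_def norm_mult norm_power)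
  have "integrable lborel (\<lambda>t. 2 * ((1 - cos (\<delta> * g t)) * w t))"
    using I[OF \<delta>] by (auto simp: has_bochner_integral_iff)
  then show f: "integrable lborel f"
  proof (rule Bochner_Integration.integrable_bound)
    show "f \<in> borel_measurable lborel" unfolding f_def by measurable
    show "AE t in lborel. norm (f t) \<le> norm (2 * ((1 - cos (\<delta> * g t)) * w t))"
      by (intro AE_I2) (simp only: norm_f real_norm_def abs_ge_self)
  qed
  \<comment> \<open>The reflection t -> -t, in the form of the affine substitution rule, conjugates
    the integrand.\<close>
  have "f (0 + - 1 * t) = cnj (f t)" for t
    by (simp add: f_def odd even exp_cnj)
  then have "integral\<^sup>L lborel f = cnj (integral\<^sup>L lborel f)"
    by (subst lborel_integral_real_affine[of "- 1" f 0]) auto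
  then have "Im (integral\<^sup>L lborel f) = 0"
    by (simp add: complex_eq_iff)
  moreover have "Re (integral\<^sup>L lborel f) = 0"
  proof -
    have f_eq: "f t = (exp (\<i> * complex_of_real ((s + 2 * \<delta>) * g t)) - 2 * exp (\<i> * complex_of_real ((s + \<delta>) * g t))
        + exp (\<i> * complex_of_real (s * g t))) * complex_of_real (w t)" for t
    proof -
      define E e where "E = exp (\<i> * complex_of_real (s * g t))" and "e = exp (\<i> * complex_of_real (\<delta> * g t))"
      have "exp (\<i> * complex_of_real ((s + 2 * \<delta>) * g t)) = E * e * e"
          "exp (\<i> * complex_of_real ((s + \<delta>) * g t)) = E * e"
        unfolding E_def e_def exp_add[symmetric] by (simp_all add: algebra_simps)
      then show ?thesis
        by (simp add: f_def E_def[symmetric] e_def[symmetric] power2_eq_square algebra_simps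
            del: of_real_mult)
    qed
    \<comment> \<open>The coefficients 1, -2, 1 sum to zero, so each cosine may be replaced by cos -
      1, which is integrable against \<open>w\<close> even if \<open>w\<close> itself is
      not.\<close>
    have Re_f: "Re (f t) = 2 * ((1 - cos ((s + \<delta>) * g t)) * w t) - (1 - cos ((s + 2 * \<delta>) * g t)) * w t
        - (1 - cos (s * g t)) * w t" for t
      unfolding f_eq by (simp add: Re_exp Im_exp algebra_simps)
    have "has_bochner_integral lborel (\<lambda>t. 2 * ((1 - cos ((s + \<delta>) * g t)) * w t)
        - (1 - cos ((s + 2 * \<delta>) * g t)) * w t - (1 - cos (s * g t)) * w t)
        (2 * (C * (s + \<delta>)) - C * (s + 2 * \<delta>) - C * s)"
      using s \<delta> by (intro has_bochner_integral_diff has_bochner_integral_mult_right I) auto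
    then have "(\<integral>t. Re (f t) \<partial>lborel) = 2 * (C * (s + \<delta>)) - C * (s + 2 * \<delta>) - C * s"
      unfolding Re_f by (rule has_bochner_integral_integral_eq)
    also have "\<dots> = 0"
      by (simp add: algebra_simps)
    finally show ?thesis
      using f by simp
  qed
  ultimately show "integral\<^sup>L lborel f = 0"
    by (simp add: complex_eq_iff)
qed

text \<open>The density has base frequency \<open>a - \<delta>\<close>, nonnegative by assumption. A
  factor of frequency s >= 0 only raises it, so the transform stays 0, whereas frequency -a lowers
  it to -\<delta>, which centres the squared difference and leaves the integral in \<open>nz\<close>
  times -2.\<close>

lemma obtain_separating_density:
  fixes g w h :: "real \<Rightarrow> real"
  assumes meas [measurable]: "g \<in> borel_measurable borel" "w \<in> borel_measurable borel"
    and odd: "\<And>t. g (- t) = - g t" and even: "\<And>t. w (- t) = w t" and w: "\<And>t. 0 \<le> w t"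
    and I: "\<And>a. 0 \<le> a \<Longrightarrow> has_bochner_integral lborel (\<lambda>t. (1 - cos (a * g t)) * w t) (C * a)"
    and \<delta>: "0 \<le> \<delta>" "\<delta> \<le> a"
    and nz: "(\<integral>t. exp (\<i> * complex_of_real (\<kappa> * h t)) * complex_of_real ((1 - cos (\<delta> * g t)) * w t) \<partial>lborel) \<noteq> 0"
  obtains f where "integrable lborel f"
    "\<And>s. 0 \<le> s \<Longrightarrow> (\<integral>t. exp (\<i> * complex_of_real (s * g t)) * f t \<partial>lborel) = 0"
    "(\<integral>t. exp (\<i> * complex_of_real (\<kappa> * h t - a * g t)) * f t \<partial>lborel) \<noteq> 0"
proof
  let ?f = "\<lambda>s t. exp (\<i> * complex_of_real (s * g t)) * (exp (\<i> * complex_of_real (\<delta> * g t)) - 1)\<^sup>2 * complex_of_real (w t)"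
  note transform = second_difference_transform[OF meas odd even w I _ \<delta>(1)]
  show "integrable lborel (?f (a - \<delta>))"
    using \<delta> by (intro transform) auto
  show "(\<integral>t. exp (\<i> * complex_of_real (s * g t)) * ?f (a - \<delta>) t \<partial>lborel) = 0" if "0 \<le> s" for s
  proof -
    have "exp (\<i> * complex_of_real (s * g t)) * ?f (a - \<delta>) t = ?f (s + (a - \<delta>)) t" for t
      by (simp add: exp_add[symmetric] mult.assoc[symmetric]) (simp add: algebra_simps)
    then have "(\<integral>t. exp (\<i> * complex_of_real (s * g t)) * ?f (a - \<delta>) t \<partial>lborel) = integral\<^sup>L lborel (?f (s + (a - \<delta>)))"
      by (simp only:)
    also have "\<dots> = 0"
      using that \<delta> by (intro transform(2)) auto
    finally show ?thesis .
  qed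
  have "exp (\<i> * complex_of_real (\<kappa> * h t - a * g t)) * ?f (a - \<delta>) t =
      - 2 * (exp (\<i> * complex_of_real (\<kappa> * h t)) * complex_of_real ((1 - cos (\<delta> * g t)) * w t))" for t
  proof -
    define e where "e = exp (\<i> * complex_of_real (\<delta> * g t))"
    \<comment> \<open>Since \<open>e\<close> is unimodular, this is e - 2 + 1/e = 2 cos - 2.\<close>
    have e: "exp (- (\<i> * complex_of_real (\<delta> * g t))) * (e - 1)\<^sup>2 = - 2 * complex_of_real (1 - cos (\<delta> * g t))"
    proof -
      have inv: "exp (- (\<i> * complex_of_real (\<delta> * g t))) * e = 1"
        by (simp add: e_def exp_add[symmetric])
      have "exp (- (\<i> * complex_of_real (\<delta> * g t))) * (e - 1)\<^sup>2 =
          (exp (- (\<i> * complex_of_real (\<delta> * g t))) * e) * (e - 2) + exp (- (\<i> * complex_of_real (\<delta> * g t)))"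
        by (simp add: power2_eq_square algebra_simps)
      also have "\<dots> = - 2 * complex_of_real (1 - cos (\<delta> * g t))"
        unfolding inv by (simp add: e_def complex_eq_iff Re_exp Im_exp)
      finally show ?thesis .
    qed
    have "exp (\<i> * complex_of_real (\<kappa> * h t - a * g t)) * exp (\<i> * complex_of_real ((a - \<delta>) * g t)) =
        exp (\<i> * complex_of_real (\<kappa> * h t)) * exp (- (\<i> * complex_of_real (\<delta> * g t)))"
      by (simp add: exp_add[symmetric]) (simp add: algebra_simps)
    then have "exp (\<i> * complex_of_real (\<kappa> * h t - a * g t)) * ?f (a - \<delta>) t =
        exp (\<i> * complex_of_real (\<kappa> * h t)) * (exp (- (\<i> * complex_of_real (\<delta> * g t))) * (e - 1)\<^sup>2) * complex_of_real (w t)"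
      by (simp add: e_def mult.assoc[symmetric])
    also have "\<dots> = - 2 * (exp (\<i> * complex_of_real (\<kappa> * h t)) * complex_of_real ((1 - cos (\<delta> * g t)) * w t))"
      unfolding e by (simp add: algebra_simps)
    finally show ?thesis .
  qed
  then show "(\<integral>t. exp (\<i> * complex_of_real (\<kappa> * h t - a * g t)) * ?f (a - \<delta>) t \<partial>lborel) \<noteq> 0"
    using nz by simp
qed

text \<open>The case \<open>g t = t\<close> of the construction. Rescaling by \<delta> turns the
  factor with exponent \<open>\<kappa> / t\<close> into one with exponent
  \<open>\<kappa> * \<delta> / t\<close>, which tends to 1 pointwise.\<close>

lemma separating_density_at_infinity:
  fixes a \<kappa> :: real
  assumes "0 < a"
  obtains f where "integrable lborel f"
    "\<And>s. 0 \<le> s \<Longrightarrow> (\<integral>t. exp (\<i> * complex_of_real (s * t)) * f t \<partial>lborel) = 0"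
    "(\<integral>t. exp (\<i> * complex_of_real (\<kappa> * (1 / t) - a * t)) * f t \<partial>lborel) \<noteq> 0"
proof -
  let ?F = "\<lambda>\<delta> t. exp (\<i> * complex_of_real (\<kappa> * (\<delta> / t)))"
  have F: "\<And>\<delta>. ?F \<delta> \<in> borel_measurable lborel" "\<And>\<delta> t. norm (?F \<delta> t) \<le> 1"
      "\<And>t. ((\<lambda>\<delta>. ?F \<delta> t) \<longlongrightarrow> 1) (at_right 0)"
    by (measurable, simp, auto intro!: tendsto_eq_intros simp: divide_inverse)
  obtain \<delta> where \<delta>: "0 < \<delta>" "\<delta> \<le> a"
    "(\<integral>t. exp (\<i> * complex_of_real (\<kappa> * (\<delta> / t))) * complex_of_real ((1 - cos t) / t\<^sup>2) \<partial>lborel) \<noteq> 0"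
    using integral_times_approximate_unit_nonzero[OF integrable_one_minus_cos(1)
        integral_one_minus_cos_pos(1) F assms] by blast
  \<comment> \<open>Substitution t -> t / \<delta>: the Jacobian and the square from
    \<open>1 / t\<^sup>2\<close> are nonzero constants, so nonvanishing carries over.\<close>
  have "(\<integral>t. exp (\<i> * complex_of_real (\<kappa> * (1 / t))) * complex_of_real ((1 - cos (\<delta> * t)) * (1 / t\<^sup>2)) \<partial>lborel) =
      (1 / \<delta>) *\<^sub>R (\<integral>t. complex_of_real (\<delta>\<^sup>2) * (exp (\<i> * complex_of_real (\<kappa> * (\<delta> / t))) * complex_of_real ((1 - cos t) / t\<^sup>2)) \<partial>lborel)"
    using \<delta>(1) by (subst lborel_integral_real_affine[of "1 / \<delta>" _ 0])
      (auto simp: power_divide mult_ac intro!: arg_cong2[where f = scaleR] Bochner_Integration.integral_cong)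
  then have nz: "(\<integral>t. exp (\<i> * complex_of_real (\<kappa> * (1 / t))) * complex_of_real ((1 - cos (\<delta> * t)) * (1 / t\<^sup>2)) \<partial>lborel) \<noteq> 0"
    using \<delta> by (subst (asm) integral_mult_right_zero) auto
  show ?thesis
  proof (rule obtain_separating_density[OF _ _ _ _ _ has_integral_one_minus_cos_scaled(1) _ \<delta>(2) nz])
    fix f :: "real \<Rightarrow> complex"
    assume "integrable lborel f"
      "\<And>s. 0 \<le> s \<Longrightarrow> (\<integral>t. exp (\<i> * complex_of_real (s * t)) * f t \<partial>lborel) = 0"
      "(\<integral>t. exp (\<i> * complex_of_real (\<kappa> * (1 / t) - a * t)) * f t \<partial>lborel) \<noteq> 0"
    then show thesis by (rule that)
  qed (use \<delta>(1) in simp_all)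
qed

text \<open>The counterpart with \<open>g t = - 1 / t\<close> and weight 1; here the substitution is
  t -> \<delta> t.\<close>

lemma separating_density_at_zero:
  fixes a \<kappa> :: real
  assumes "0 < a"
  obtains f where "integrable lborel f"
    "\<And>s. 0 \<le> s \<Longrightarrow> (\<integral>t. exp (\<i> * complex_of_real (s * (- 1 / t))) * f t \<partial>lborel) = 0"
    "(\<integral>t. exp (\<i> * complex_of_real (\<kappa> * t - a * (- 1 / t))) * f t \<partial>lborel) \<noteq> 0"
proof -
  let ?F = "\<lambda>\<delta> t. exp (\<i> * complex_of_real (\<kappa> * (\<delta> * t)))"
  have F: "\<And>\<delta>. ?F \<delta> \<in> borel_measurable lborel" "\<And>\<delta> t. norm (?F \<delta> t) \<le> 1"
      "\<And>t. ((\<lambda>\<delta>. ?F \<delta> t) \<longlongrightarrow> 1) (at_right 0)"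
    by (measurable, simp, auto intro!: tendsto_eq_intros simp: divide_inverse)
  obtain \<delta> where \<delta>: "0 < \<delta>" "\<delta> \<le> a"
    "(\<integral>t. exp (\<i> * complex_of_real (\<kappa> * (\<delta> * t))) * complex_of_real (1 - cos (1 / t)) \<partial>lborel) \<noteq> 0"
    using integral_times_approximate_unit_nonzero[OF integrable_one_minus_cos(2)
        integral_one_minus_cos_pos(2) F assms] by blast
  have "(\<integral>t. exp (\<i> * complex_of_real (\<kappa> * t)) * complex_of_real ((1 - cos (\<delta> * (- 1 / t))) * 1) \<partial>lborel) =
      \<delta> *\<^sub>R (\<integral>t. exp (\<i> * complex_of_real (\<kappa> * (\<delta> * t))) * complex_of_real (1 - cos (1 / t)) \<partial>lborel)"
    using \<delta>(1) by (subst lborel_integral_real_affine[of \<delta> _ 0])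
      (auto intro!: arg_cong2[where f = scaleR] Bochner_Integration.integral_cong)
  then have nz: "(\<integral>t. exp (\<i> * complex_of_real (\<kappa> * t)) * complex_of_real ((1 - cos (\<delta> * (- 1 / t))) * 1) \<partial>lborel) \<noteq> 0"
    using \<delta> by auto
  show ?thesis
  proof (rule obtain_separating_density[OF _ _ _ _ _ has_integral_one_minus_cos_scaled(2) _ \<delta>(2) nz])
    fix f :: "real \<Rightarrow> complex"
    assume "integrable lborel f"
      "\<And>s. 0 \<le> s \<Longrightarrow> (\<integral>t. exp (\<i> * complex_of_real (s * (- 1 / t))) * f t \<partial>lborel) = 0"
      "(\<integral>t. exp (\<i> * complex_of_real (\<kappa> * t - a * (- 1 / t))) * f t \<partial>lborel) \<noteq> 0"
    then show thesis by (rule that)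
  qed (use \<delta>(1) in simp_all)
qed

section \<open>The hyperbola and its absolutely continuous measures\<close>

lemma hyperbola_borel [measurable]: "hyperbola M \<in> sets borel"
proof -
  have "hyperbola M = {x. fst x * snd x = M\<^sup>2 / (4 * pi\<^sup>2)}"
    by (auto simp: hyperbola_def)
  also have "\<dots> \<in> sets borel"
    by (intro borel_closed closed_Collect_eq continuous_intros)
  finally show ?thesis .
qed

text \<open>The curve underlying \<open>hyperbola_arc_length\<close>, now total on the line: at t =
  0 division by zero gives the origin, a single parameter that is Lebesgue null.\<close>

definition hyperbola_param :: "real \<Rightarrow> real \<Rightarrow> real \<times> real" where
  "hyperbola_param M t = (t, M\<^sup>2 / (4 * pi\<^sup>2 * t))"

lemma hyperbola_param_measurable [measurable]: "hyperbola_param M \<in> borel_measurable borel"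
  unfolding hyperbola_param_def by measurable

lemma hyperbola_param_in_hyperbola: "t \<noteq> 0 \<Longrightarrow> hyperbola_param M t \<in> hyperbola M"
  by (simp add: hyperbola_param_def hyperbola_def)

lemma norm_vector_derivative_hyperbola_param:
  assumes "t \<noteq> 0"
  shows "norm (vector_derivative (hyperbola_param M) (at t)) = sqrt (1 + (M\<^sup>2 / (4 * pi\<^sup>2 * t\<^sup>2))\<^sup>2)"
proof -
  have "(hyperbola_param M has_vector_derivative (1, - (M\<^sup>2 / (4 * pi\<^sup>2 * t\<^sup>2)))) (at t)"
    unfolding hyperbola_param_def using assms
    by (intro has_vector_derivative_Pair)
      (auto intro!: derivative_eq_intros simp: has_real_derivative_iff_has_vector_derivative[symmetric] power2_eq_square field_simps)
  then show ?thesis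
    by (simp add: vector_derivative_at norm_Pair)
qed

text \<open>The speed of the curve is strictly positive away from t = 0, so arc length null sets
  pull back to Lebesgue null sets.\<close>

lemma AE_hyperbola_param_if_arc_length_null:
  assumes A [measurable]: "A \<in> sets borel" and null: "emeasure (hyperbola_arc_length M) A = 0"
  shows "AE t in lborel. hyperbola_param M t \<notin> A"
proof -
  let ?R = "restrict_space lborel (- {0 :: real})"
  let ?n = "\<lambda>t. ennreal (norm (vector_derivative (hyperbola_param M) (at t)))"
  \<comment> \<open>Measurability of the speed is read off its closed form, valid on the restricted
    space.\<close>
  have "(\<lambda>t. ennreal (sqrt (1 + (M\<^sup>2 / (4 * pi\<^sup>2 * t\<^sup>2))\<^sup>2))) \<in> borel_measurable ?R"
    by (intro measurable_restrict_space1) measurable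
  then have n [measurable]: "?n \<in> borel_measurable ?R"
    by (rule measurable_cong[THEN iffD1, rotated])
      (auto simp: space_restrict_space norm_vector_derivative_hyperbola_param)
  have p [measurable]: "hyperbola_param M \<in> ?R \<rightarrow>\<^sub>M borel"
    by (intro measurable_restrict_space1) measurable
  have "0 = emeasure (distr (density ?R ?n) borel (hyperbola_param M)) A"
    using null by (simp add: hyperbola_arc_length_def arc_length_measure_def hyperbola_param_def[abs_def])
  also have "\<dots> = (\<integral>\<^sup>+t. ?n t * indicator A (hyperbola_param M t) \<partial>?R)"
    by (subst emeasure_distr, measurable, subst emeasure_density, measurable)
       (auto intro!: nn_integral_cong simp: indicator_def)
  finally have "AE t in ?R. ?n t * indicator A (hyperbola_param M t) = 0"
    by (subst (asm) eq_commute, subst (asm) nn_integral_0_iff_AE) auto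
  then have "AE t in lborel. t \<in> - {0} \<longrightarrow> ?n t * indicator A (hyperbola_param M t) = 0"
    by (subst (asm) AE_restrict_space_iff) auto
  moreover have "AE t in lborel. t \<noteq> (0 :: real)"
    by (rule AE_lborel_singleton)
  ultimately show ?thesis
  proof eventually_elim
    case (elim t)
    have "0 < norm (vector_derivative (hyperbola_param M) (at t))"
      unfolding norm_vector_derivative_hyperbola_param[OF elim(2)] by (simp add: add_pos_nonneg)
    then show ?case
      using elim by (auto simp: indicator_def split: if_splits)
  qed
qed

lemma density_image_in_AC:
  assumes f: "integrable lborel f"
  shows "density_image lborel (hyperbola_param M) f \<in> AC M"
proof -
  have zero: "density_image lborel (hyperbola_param M) f A = 0"
    if "AE t in lborel. hyperbola_param M t \<notin> A" for A
  proof -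
    have "AE t in lborel. indicat_real A (hyperbola_param M t) *\<^sub>R f t = 0"
      using that by eventually_elim simp
    then show ?thesis
      unfolding density_image_def by (rule integral_eq_zero_AE)
  qed
  have "AE t in lborel. hyperbola_param M t \<notin> A" if "A \<inter> hyperbola M = {}" for A
    using AE_lborel_singleton[of 0] by eventually_elim (use hyperbola_param_in_hyperbola that in auto)
  then show ?thesis
    unfolding AC_def complex_measure_def
    using density_image_sums[OF f, of "hyperbola_param M" borel] zero AE_hyperbola_param_if_arc_length_null
    by auto
qed

lemma fourier_transform_density_image:
  assumes f: "integrable lborel f"
  shows "fourier_transform (density_image lborel (hyperbola_param M) f) (\<xi>1, \<xi>2) =
    (\<integral>t. exp (\<i> * complex_of_real (pi * \<xi>1 * t + M\<^sup>2 / (4 * pi) * \<xi>2 / t)) * f t \<partial>lborel)"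
proof -
  have "fourier_transform (density_image lborel (hyperbola_param M) f) (\<xi>1, \<xi>2) =
    (\<integral>t. exp (\<i> * complex_of_real pi * complex_of_real (hyperbola_param M t \<bullet> (\<xi>1, \<xi>2))) * f t \<partial>lborel)"
    unfolding fourier_transform_def
  \<comment> \<open>The first coordinate \<open>fst\<close> is the measurable left inverse of the
    parametrization.\<close>
  proof (rule complex_measure_integral_density_image[OF f, of _ _ fst])
    show "fst \<in> borel \<rightarrow>\<^sub>M (lborel :: real measure)"
      using borel_measurable_continuous_onI[OF continuous_on_fst[OF continuous_on_id]] by simp
    show "(\<lambda>x. exp (\<i> * complex_of_real pi * complex_of_real (x \<bullet> (\<xi>1, \<xi>2)))) \<in> borel_measurable borel"
      by (intro borel_measurable_continuous_onI continuous_intros)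
    show "norm (exp (\<i> * complex_of_real pi * complex_of_real (x \<bullet> (\<xi>1, \<xi>2)))) \<le> 1" for x
      by (simp add: mult.assoc of_real_mult[symmetric] del: of_real_mult)
  qed (auto simp: hyperbola_param_def)
  also have "\<dots> = (\<integral>t. exp (\<i> * complex_of_real (pi * \<xi>1 * t + M\<^sup>2 / (4 * pi) * \<xi>2 / t)) * f t \<partial>lborel)"
  proof (intro Bochner_Integration.integral_cong refl)
    fix t
    have "pi * (hyperbola_param M t \<bullet> (\<xi>1, \<xi>2)) = pi * \<xi>1 * t + M\<^sup>2 / (4 * pi) * \<xi>2 / t"
      by (simp add: hyperbola_param_def inner_prod_def power2_eq_square distrib_left)
    then show "exp (\<i> * complex_of_real pi * complex_of_real (hyperbola_param M t \<bullet> (\<xi>1, \<xi>2))) * f t =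
        exp (\<i> * complex_of_real (pi * \<xi>1 * t + M\<^sup>2 / (4 * pi) * \<xi>2 / t)) * f t"
      by (metis mult.assoc of_real_mult)
  qed
  finally show ?thesis .
qed

section \<open>Vanishing on a closed quadrant\<close>

text \<open>On the hyperbola \<open>v\<close> is \<open>k / u\<close> and \<open>u\<close> has no
  zeros, so the inner factor in \<open>u\<close> is a character in \<open>v\<close>. Keeping
  \<open>u\<close> and \<open>v\<close> abstract lets either coordinate, with either sign, take the
  role of \<open>u\<close>.\<close>

lemma complex_measure_integral_quadrant_eq_0:
  assumes \<mu>: "\<mu> \<in> AC M"
    and [measurable]: "u \<in> borel_measurable borel" "v \<in> borel_measurable borel"
    and uv: "\<And>x. x \<in> hyperbola M \<Longrightarrow> u x * v x = k" and k: "0 < k"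
    and zero: "\<And>s. 0 < s \<Longrightarrow> complex_measure_integral borel \<mu> (\<lambda>x. exp (\<i> * complex_of_real (s * u x))) = 0"
    and s: "0 \<le> s" and \<tau>: "0 \<le> \<tau>"
  shows "complex_measure_integral borel \<mu> (\<lambda>x. exp (\<i> * complex_of_real (s * u x - \<tau> * v x))) = 0"
proof -
  have \<mu>': "complex_measure borel \<mu>" "\<And>A. A \<in> sets borel \<Longrightarrow> A \<inter> hyperbola M = {} \<Longrightarrow> \<mu> A = 0"
    using \<mu> by (simp_all add: AC_def)
  obtain P :: "nat \<Rightarrow> (real \<times> real) measure" and c where P: "\<And>k. finite_measure (P k)" "\<And>k. sets (P k) = sets borel"
      "\<And>k. AE x in P k. x \<in> hyperbola M"
    and int: "\<And>f. complex_measure_integral borel \<mu> f = (\<Sum>k<4. c k * integral\<^sup>L (P k) f)"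
  proof (rule complex_measure_integral_decomposition[OF \<mu>'(1) hyperbola_borel \<mu>'(2)])
    fix P :: "nat \<Rightarrow> (real \<times> real) measure" and c
    assume "\<And>k. finite_measure (P k)" "\<And>k. sets (P k) = sets borel" "\<And>k. AE x in P k. x \<in> hyperbola M"
      "\<And>f. complex_measure_integral borel \<mu> f = (\<Sum>k<4. c k * integral\<^sup>L (P k) f)"
    then show thesis by (rule that)
  qed
  have meas: "u \<in> borel_measurable (P k)" "v \<in> borel_measurable (P k)" for k
    by (simp_all add: measurable_cong_sets[OF P(2) refl])
  have nz: "AE x in P k. u x \<noteq> 0" for k
    using P(3)[of k] by eventually_elim (use uv k in \<open>metis mult_zero_left less_irrefl\<close>)
  \<comment> \<open>The parameter of the inner factor is \<open>\<tau> * k\<close>, to absorb the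
    constant product of \<open>u\<close> and \<open>v\<close>.\<close>
  have "(\<Sum>j<4. c j * (\<integral>x. exp (\<i> * complex_of_real (s * u x - \<tau> * k / u x)) \<partial>P j)) = 0"
    using s \<tau> k zero by (intro sum_integral_inner_factor_eq_0 P meas(1) nz) (auto simp: int)
  moreover have "(\<integral>x. exp (\<i> * complex_of_real (s * u x - \<tau> * k / u x)) \<partial>P j) =
      (\<integral>x. exp (\<i> * complex_of_real (s * u x - \<tau> * v x)) \<partial>P j)" for j
  proof (rule integral_cong_AE)
    have v: "AE x in P j. k / u x = v x"
      using P(3)[of j] nz[of j] by eventually_elim (use uv in \<open>simp add: divide_eq_eq mult.commute\<close>)
    show "AE x in P j. exp (\<i> * complex_of_real (s * u x - \<tau> * k / u x)) =
        exp (\<i> * complex_of_real (s * u x - \<tau> * v x))"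
      using v by eventually_elim (simp flip: times_divide_eq_right)
  qed (use meas[of j] in measurable)
  ultimately show ?thesis
    by (simp add: int)
qed

lemma fourier_transform_vanishes_on_quadrant:
  assumes "M > 0" "\<mu> \<in> AC M"
  shows "(\<forall>\<eta> \<in> {0<..} \<times> {0}. fourier_transform \<mu> \<eta> = 0) \<Longrightarrow> \<xi> \<in> {0..} \<times> {..0} \<Longrightarrow> fourier_transform \<mu> \<xi> = 0"
    and "(\<forall>\<eta> \<in> {0} \<times> {..<0}. fourier_transform \<mu> \<eta> = 0) \<Longrightarrow> \<xi> \<in> {0..} \<times> {..0} \<Longrightarrow> fourier_transform \<mu> \<xi> = 0"
    and "(\<forall>\<eta> \<in> {..<0} \<times> {0}. fourier_transform \<mu> \<eta> = 0) \<Longrightarrow> \<xi> \<in> {..0} \<times> {0..} \<Longrightarrow> fourier_transform \<mu> \<xi> = 0"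
    and "(\<forall>\<eta> \<in> {0} \<times> {0<..}. fourier_transform \<mu> \<eta> = 0) \<Longrightarrow> \<xi> \<in> {..0} \<times> {0..} \<Longrightarrow> fourier_transform \<mu> \<xi> = 0"
proof -
  have FT: "fourier_transform \<mu> (a, b) =
      complex_measure_integral borel \<mu> (\<lambda>x. exp (\<i> * complex_of_real (pi * (fst x * a + snd x * b))))" for a b
    by (simp add: fourier_transform_def inner_prod_def mult.assoc)
  obtain a b where \<xi>: "\<xi> = (a, b)" by (cases \<xi>)
  have k: "0 < pi\<^sup>2 * (M\<^sup>2 / (4 * pi\<^sup>2))"
    using assms(1) by simp
  have hyp: "fst x * snd x = M\<^sup>2 / (4 * pi\<^sup>2)" if "x \<in> hyperbola M" for x
    using that by (auto simp: hyperbola_def)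
  \<comment> \<open>\<sigma> is the sign of the semi-axis. Scaling both coordinates by
    \<open>\<sigma> * pi\<close> keeps their product positive and makes the parameters
    \<open>\<sigma> * a\<close> and \<open>- \<sigma> * b\<close> nonnegative on the quadrant; claim
    2 exchanges the coordinates.\<close>
  have 1: "fourier_transform \<mu> (a, b) = 0"
    if \<sigma>: "\<sigma> = 1 \<or> \<sigma> = (-1 :: real)" and zero: "\<And>s. 0 < s \<Longrightarrow> fourier_transform \<mu> (\<sigma> * s, 0) = 0"
      and ab: "0 \<le> \<sigma> * a" "0 \<le> - \<sigma> * b" for \<sigma>
  proof -
    have "complex_measure_integral borel \<mu> (\<lambda>x. exp (\<i> * complex_of_real
        ((\<sigma> * a) * (\<sigma> * pi * fst x) - (- \<sigma> * b) * (\<sigma> * pi * snd x)))) = 0"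
    proof (rule complex_measure_integral_quadrant_eq_0[OF assms(2) _ _ _ k _ ab])
      show "(\<sigma> * pi * fst x) * (\<sigma> * pi * snd x) = pi\<^sup>2 * (M\<^sup>2 / (4 * pi\<^sup>2))" if "x \<in> hyperbola M" for x
        unfolding hyp[OF that, symmetric] using \<sigma> by (auto simp: power2_eq_square)
      show "complex_measure_integral borel \<mu> (\<lambda>x. exp (\<i> * complex_of_real (s * (\<sigma> * pi * fst x)))) = 0"
        if "0 < s" for s
        using zero[OF that] by (simp add: FT mult_ac)
    qed (intro borel_measurable_continuous_onI continuous_intros)+
    moreover have "(\<sigma> * a) * (\<sigma> * pi * fst x) - (- \<sigma> * b) * (\<sigma> * pi * snd x) = pi * (fst x * a + snd x * b)"
      for x :: "real \<times> real"
      using \<sigma> by (auto simp: algebra_simps)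
    ultimately show ?thesis
      by (simp only: FT)
  qed
  have 2: "fourier_transform \<mu> (a, b) = 0"
    if \<sigma>: "\<sigma> = 1 \<or> \<sigma> = (-1 :: real)" and zero: "\<And>s. 0 < s \<Longrightarrow> fourier_transform \<mu> (0, \<sigma> * s) = 0"
      and ab: "0 \<le> \<sigma> * b" "0 \<le> - \<sigma> * a" for \<sigma>
  proof -
    have "complex_measure_integral borel \<mu> (\<lambda>x. exp (\<i> * complex_of_real
        ((\<sigma> * b) * (\<sigma> * pi * snd x) - (- \<sigma> * a) * (\<sigma> * pi * fst x)))) = 0"
    proof (rule complex_measure_integral_quadrant_eq_0[OF assms(2) _ _ _ k _ ab])
      show "(\<sigma> * pi * snd x) * (\<sigma> * pi * fst x) = pi\<^sup>2 * (M\<^sup>2 / (4 * pi\<^sup>2))" if "x \<in> hyperbola M" for x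
        unfolding hyp[OF that, symmetric] using \<sigma> by (auto simp: power2_eq_square)
      show "complex_measure_integral borel \<mu> (\<lambda>x. exp (\<i> * complex_of_real (s * (\<sigma> * pi * snd x)))) = 0"
        if "0 < s" for s
        using zero[OF that] by (simp add: FT mult_ac)
    qed (intro borel_measurable_continuous_onI continuous_intros)+
    moreover have "(\<sigma> * b) * (\<sigma> * pi * snd x) - (- \<sigma> * a) * (\<sigma> * pi * fst x) = pi * (fst x * a + snd x * b)"
      for x :: "real \<times> real"
      using \<sigma> by (auto simp: algebra_simps)
    ultimately show ?thesis
      by (simp only: FT)
  qed
  show "(\<forall>\<eta> \<in> {0<..} \<times> {0}. fourier_transform \<mu> \<eta> = 0) \<Longrightarrow> \<xi> \<in> {0..} \<times> {..0} \<Longrightarrow> fourier_transform \<mu> \<xi> = 0"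
    unfolding \<xi> by (rule 1[of 1]) auto
  show "(\<forall>\<eta> \<in> {0} \<times> {..<0}. fourier_transform \<mu> \<eta> = 0) \<Longrightarrow> \<xi> \<in> {0..} \<times> {..0} \<Longrightarrow> fourier_transform \<mu> \<xi> = 0"
    unfolding \<xi> by (rule 2[of "-1"]) auto
  show "(\<forall>\<eta> \<in> {..<0} \<times> {0}. fourier_transform \<mu> \<eta> = 0) \<Longrightarrow> \<xi> \<in> {..0} \<times> {0..} \<Longrightarrow> fourier_transform \<mu> \<xi> = 0"
    unfolding \<xi> by (rule 1[of "-1"]) auto
  show "(\<forall>\<eta> \<in> {0} \<times> {0<..}. fourier_transform \<mu> \<eta> = 0) \<Longrightarrow> \<xi> \<in> {..0} \<times> {0..} \<Longrightarrow> fourier_transform \<mu> \<xi> = 0"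
    unfolding \<xi> by (rule 2[of 1]) auto
qed

section \<open>Separating points from a quadrant\<close>

text \<open>Conjugation exchanges the Jordan parts of the imaginary part and conjugates the
  characters. It serves to pass from one quadrant to the opposite one.\<close>

lemma fourier_transform_cnj:
  "fourier_transform (\<lambda>A. cnj (\<mu> A)) \<xi> = cnj (fourier_transform \<mu> (- \<xi>))"
proof -
  have "cnj (\<integral>x. exp (\<i> * complex_of_real pi * complex_of_real (x \<bullet> - \<xi>)) \<partial>N) =
      (\<integral>x. exp (\<i> * complex_of_real pi * complex_of_real (x \<bullet> \<xi>)) \<partial>N)" for N
    by (simp add: exp_cnj flip: Bochner_Integration.integral_cnj)
  then show ?thesis
    by (simp add: fourier_transform_def complex_measure_integral_def del: inner_minus_right)
      (simp add: algebra_simps)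
qed

lemma cnj_in_AC: "\<mu> \<in> AC M \<Longrightarrow> (\<lambda>A. cnj (\<mu> A)) \<in> AC M"
  by (auto simp: AC_def complex_measure_def sums_cnj)

text \<open>Outside the quadrant the first coordinate is negative or the second positive. Each case
  has a density annihilating one of the two bounding semi-axes, and the vanishing lemma spreads
  these zeros over the whole quadrant.\<close>

lemma separating_measure:
  assumes "M > 0" "\<xi> \<notin> {0..} \<times> {..0}"
  shows "\<exists>\<mu> \<in> AC M. (\<forall>\<eta> \<in> {0..} \<times> {..0}. fourier_transform \<mu> \<eta> = 0) \<and> fourier_transform \<mu> \<xi> \<noteq> 0"
proof -
  obtain \<xi>1 \<xi>2 where \<xi>: "\<xi> = (\<xi>1, \<xi>2)" by (cases \<xi>)
  define k where "k = M\<^sup>2 / (4 * pi)"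
  have k: "0 < k" using assms(1) by (simp add: k_def)
  note FT = fourier_transform_density_image[where M = M, folded k_def]
  consider "\<xi>1 < 0" | "0 < \<xi>2"
    using assms(2) by (force simp: \<xi>)
  then show ?thesis
  proof cases
    case 1
    \<comment> \<open>The transform has exponent \<open>pi * \<xi>1 * t + k * \<xi>2 / t\<close>, so
      the coefficient of \<open>t\<close> is minus this positive number.\<close>
    then have pos: "0 < - pi * \<xi>1" by (simp add: mult_pos_neg)
    obtain f where f: "integrable lborel f"
        "\<And>s. 0 \<le> s \<Longrightarrow> (\<integral>t. exp (\<i> * complex_of_real (s * t)) * f t \<partial>lborel) = 0"
        "(\<integral>t. exp (\<i> * complex_of_real (k * \<xi>2 * (1 / t) - - pi * \<xi>1 * t)) * f t \<partial>lborel) \<noteq> 0"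
      using separating_density_at_infinity[OF pos, of "k * \<xi>2"] by blast
    let ?\<mu> = "density_image lborel (hyperbola_param M) f"
    have "fourier_transform ?\<mu> \<xi> \<noteq> 0"
      using f(3) by (simp add: \<xi> FT[OF f(1)] add.commute)
    moreover have "\<forall>\<eta> \<in> {0<..} \<times> {0}. fourier_transform ?\<mu> \<eta> = 0"
      using f(2) by (auto simp: FT[OF f(1)] simp del: of_real_mult)
    ultimately show ?thesis
      using fourier_transform_vanishes_on_quadrant(1)[OF assms(1) density_image_in_AC[OF f(1)]]
        density_image_in_AC[OF f(1)] by blast
  next
    case 2
    with k have pos: "0 < k * \<xi>2" by simp
    obtain f where f: "integrable lborel f"
        "\<And>s. 0 \<le> s \<Longrightarrow> (\<integral>t. exp (\<i> * complex_of_real (s * (- 1 / t))) * f t \<partial>lborel) = 0"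
        "(\<integral>t. exp (\<i> * complex_of_real (pi * \<xi>1 * t - k * \<xi>2 * (- 1 / t))) * f t \<partial>lborel) \<noteq> 0"
      using separating_density_at_zero[OF pos, of "pi * \<xi>1"] by blast
    let ?\<mu> = "density_image lborel (hyperbola_param M) f"
    have "fourier_transform ?\<mu> \<xi> \<noteq> 0"
      using f(3) by (simp add: \<xi> FT[OF f(1)])
    \<comment> \<open>The frequency along \<open>- 1 / t\<close> is \<open>- k * y\<close>,
      nonnegative on the negative semi-axis.\<close>
    moreover have "fourier_transform ?\<mu> (0, y) = 0" if "y < 0" for y
      using f(2)[of "- k * y"] that k by (simp add: FT[OF f(1)] mult_nonneg_nonpos)
    then have "\<forall>\<eta> \<in> {0} \<times> {..<0}. fourier_transform ?\<mu> \<eta> = 0"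
      by auto
    ultimately show ?thesis
      using fourier_transform_vanishes_on_quadrant(2)[OF assms(1) density_image_in_AC[OF f(1)]]
        density_image_in_AC[OF f(1)] by blast
  qed
qed

lemma separating_measure_opposite:
  assumes "M > 0" "\<xi> \<notin> {..0} \<times> {0..}"
  shows "\<exists>\<mu> \<in> AC M. (\<forall>\<eta> \<in> {..0} \<times> {0..}. fourier_transform \<mu> \<eta> = 0) \<and> fourier_transform \<mu> \<xi> \<noteq> 0"
proof -
  have "- \<xi> \<notin> {0..} \<times> {..0}"
    using assms(2) by (cases \<xi>) auto
  then obtain \<mu> where \<mu>: "\<mu> \<in> AC M" "\<forall>\<eta> \<in> {0..} \<times> {..0}. fourier_transform \<mu> \<eta> = 0"
      "fourier_transform \<mu> (- \<xi>) \<noteq> 0"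
    using separating_measure[OF assms(1)] by blast
  show ?thesis
  proof (intro bexI[OF _ cnj_in_AC[OF \<mu>(1)]] conjI ballI)
    fix \<eta> :: "real \<times> real"
    assume "\<eta> \<in> {..0} \<times> {0..}"
    then have "- \<eta> \<in> {0..} \<times> {..0}" by (cases \<eta>) auto
    then show "fourier_transform (\<lambda>A. cnj (\<mu> A)) \<eta> = 0"
      unfolding fourier_transform_cnj using \<mu>(2) by (metis complex_cnj_zero)
  qed (use \<mu>(3) in \<open>simp add: fourier_transform_cnj\<close>)
qed

text \<open>Separating measures are asked to vanish on all of \<open>Q\<close>, hence on
  \<open>\<Lambda>\<close>, so one separation result serves both semi-axes bounding a
  quadrant.\<close>

lemma zclos_eqI:
  assumes "\<Lambda> \<subseteq> Q"
    and "\<And>\<mu> \<xi>. \<mu> \<in> AC M \<Longrightarrow> \<forall>\<eta> \<in> \<Lambda>. fourier_transform \<mu> \<eta> = 0 \<Longrightarrow> \<xi> \<in> Q \<Longrightarrow> fourier_transform \<mu> \<xi> = 0"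
    and "\<And>\<xi>. \<xi> \<notin> Q \<Longrightarrow> \<exists>\<mu> \<in> AC M. (\<forall>\<eta> \<in> Q. fourier_transform \<mu> \<eta> = 0) \<and> fourier_transform \<mu> \<xi> \<noteq> 0"
  shows "zclos M \<Lambda> = Q"
  using assms unfolding zclos_def by blast

theorem proposition1p7p2:
  fixes M :: real
  assumes "M > 0"
  shows "zclos M ({0<..} \<times> {0}) = {0..} \<times> {..0}
       \<and> zclos M ({0} \<times> {..<0}) = {0..} \<times> {..0}
       \<and> zclos M ({..<0} \<times> {0}) = {..0} \<times> {0..}
       \<and> zclos M ({0} \<times> {0<..}) = {..0} \<times> {0..}"
proof (intro conjI)
  note vanish = fourier_transform_vanishes_on_quadrant[OF assms]
  show "zclos M ({0<..} \<times> {0}) = {0..} \<times> {..0}"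
    by (rule zclos_eqI[OF _ vanish(1) separating_measure[OF assms]]) auto
  show "zclos M ({0} \<times> {..<0}) = {0..} \<times> {..0}"
    by (rule zclos_eqI[OF _ vanish(2) separating_measure[OF assms]]) auto
  show "zclos M ({..<0} \<times> {0}) = {..0} \<times> {0..}"
    by (rule zclos_eqI[OF _ vanish(3) separating_measure_opposite[OF assms]]) auto
  show "zclos M ({0} \<times> {0<..}) = {..0} \<times> {0..}"
    by (rule zclos_eqI[OF _ vanish(4) separating_measure_opposite[OF assms]]) auto
qed

end
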